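(* Let $k$ and $\ell$ be natural numbers such that there exists an algorithm solving the identity problem in every $(k,\ell)$-group. Then there exists an algorithm solving the identity problem in any $(k,\ell)$-semigroup.
   Context: Words over a finite alphabet are elements of the free monoid; $1$ denotes the empty word and $|X|$ the length of $X$. A $(k,\ell)$-semigroup is a monoid $\Pi$ given by a finite alphabet $a_1,\dots,a_n$ and $k$ defining relations $A_i=1$ ($i=1,\dots,k$), where each $A_i$ is a word over the alphabet with $|A_i|\le \ell$. Two words are equal in $\Pi$ if one can be transformed into the other by finitely many insertions or deletions of subwords $A_i$. A word $X$ is two-sided invertible in $\Pi$ if there are words $Y,Z$ with $YX=1$ and $XZ=1$ in $\Pi$. A $(k,\ell)$-group is a $(k,\ell)$-semigroup in which every word is two-sided invertible. The identity problem for a given presentation is the problem of deciding, for any two words $X,Y$ over its alphabet, whether $X=Y$ in the presented semigroup. "An algorithm solving the identity problem in every $(k,\ell)$-group" (resp. "in any $(k,\ell)$-semigroup") means an algorithm which, given the presentation of a $(k,\ell)$-group (resp. $(k,\ell)$-semigroup) and two words over its alphabet, decides whether the words are equal in it. *)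

theory Defs
  imports Main "HOL-Library.Nat_Bijection"
begin

text \<open>
  The alphabet \<open>a\<^sub>1, \<dots>, a\<^sub>n\<close> is encoded as \<open>{..<n}\<close>. A presentation is a pair \<open>(n, As)\<close> of the
  number of letters and the list of the left-hand sides of the defining relations \<open>A = 1\<close>; the
  list may contain repetitions and the empty word.
\<close>

type_synonym word = "nat list"
type_synonym presentation = "nat \<times> word list"

definition words :: "presentation \<Rightarrow> word set" where
  "words \<Pi> = lists {..<fst \<Pi>}"

definition insertion :: "presentation \<Rightarrow> word \<Rightarrow> word \<Rightarrow> bool" where
  "insertion \<Pi> X Y \<longleftrightarrow> (\<exists>U A V. A \<in> set (snd \<Pi>) \<and> X = U @ V \<and> Y = U @ A @ V)"

definition eq_in :: "presentation \<Rightarrow> word \<Rightarrow> word \<Rightarrow> bool" where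
  "eq_in \<Pi> = equivclp (insertion \<Pi>)"

definition two_sided_invertible :: "presentation \<Rightarrow> word \<Rightarrow> bool" where
  "two_sided_invertible \<Pi> X \<longleftrightarrow>
     (\<exists>Y \<in> words \<Pi>. eq_in \<Pi> (Y @ X) []) \<and> (\<exists>Z \<in> words \<Pi>. eq_in \<Pi> (X @ Z) [])"

definition kl_semigroup :: "nat \<Rightarrow> nat \<Rightarrow> presentation \<Rightarrow> bool" where
  "kl_semigroup k l \<Pi> \<longleftrightarrow>
     length (snd \<Pi>) = k \<and> (\<forall>A \<in> set (snd \<Pi>). A \<in> words \<Pi> \<and> length A \<le> l)"

definition kl_group :: "nat \<Rightarrow> nat \<Rightarrow> presentation \<Rightarrow> bool" where
  "kl_group k l \<Pi> \<longleftrightarrow>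
     kl_semigroup k l \<Pi> \<and> (\<forall>X \<in> words \<Pi>. two_sided_invertible \<Pi> X)"

text \<open>
  Algorithms are Kleene's partial recursive functions: \<open>computes f xs y\<close> says that \<open>f\<close> halts on the
  arguments \<open>xs\<close> with result \<open>y\<close>. Arities are not tracked: each \<open>f\<close> denotes one partial
  function for every length of \<open>xs\<close>. In \<open>PrimRec\<close> and \<open>Mu\<close> the recursion or search variable comes first.
\<close>

datatype recf = Zero | Succ | Proj nat | Comp recf "recf list" | PrimRec recf recf | Mu recf

inductive computes :: "recf \<Rightarrow> nat list \<Rightarrow> nat \<Rightarrow> bool" where
  Zero: "computes Zero xs 0"
| Succ: "computes Succ [x] (Suc x)"
| Proj: "i < length xs \<Longrightarrow> computes (Proj i) xs (xs ! i)"
| Comp: "list_all2 (\<lambda>g y. computes g xs y) gs ys \<Longrightarrow> computes f ys z \<Longrightarrow>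
    computes (Comp f gs) xs z"
| PrimRec_0: "computes f xs y \<Longrightarrow> computes (PrimRec f g) (0 # xs) y"
| PrimRec_Suc: "computes (PrimRec f g) (m # xs) y \<Longrightarrow> computes g (m # y # xs) z \<Longrightarrow>
    computes (PrimRec f g) (Suc m # xs) z"
| Mu: "computes f (m # xs) 0 \<Longrightarrow> (\<And>i. i < m \<Longrightarrow> \<exists>y. computes f (i # xs) (Suc y)) \<Longrightarrow>
    computes (Mu f) xs m"

inductive_cases computes_ZeroE: "computes Zero xs y"
inductive_cases computes_SuccE: "computes Succ [x] y"
inductive_cases computes_ProjE: "computes (Proj i) xs y"
inductive_cases computes_CompE: "computes (Comp f gs) xs y"
inductive_cases computes_PrimRec_0E: "computes (PrimRec f g) (0 # xs) y"
inductive_cases computes_PrimRec_SucE: "computes (PrimRec f g) (Suc m # xs) y"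
inductive_cases computes_MuE: "computes (Mu f) xs y"

lemma computes_deterministic: "computes f xs y \<Longrightarrow> computes f xs z \<Longrightarrow> y = z"
proof (induction arbitrary: z rule: computes.induct)
  case (Zero xs)
  then show ?case by (blast elim: computes_ZeroE)
next
  case (Succ x)
  then show ?case by (blast elim: computes_SuccE)
next
  case (Proj i xs)
  then show ?case by (blast elim: computes_ProjE)
next
  case (Comp xs gs ys f w)
  from Comp.prems show ?case
  proof (rule computes_CompE)
    fix us
    assume us: "list_all2 (\<lambda>g y. computes g xs y) gs us" "computes f us z"
    have "us = ys"
    proof (rule nth_equalityI)
      show "length us = length ys"
        using list_all2_lengthD[OF us(1)] list_all2_lengthD[OF Comp.IH(1)] by simp
      show "us ! i = ys ! i" if "i < length us" for i
      proof -
        have "i < length gs" using that list_all2_lengthD[OF us(1)] by simp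
        with us(1) Comp.IH(1) show ?thesis
          by (auto simp: list_all2_conv_all_nth)
      qed
    qed
    with us(2) Comp.IH(2) show "w = z" by blast
  qed
next
  case (PrimRec_0 f xs y g)
  from PrimRec_0.prems have "computes f xs z" by (rule computes_PrimRec_0E)
  then show ?case by (rule PrimRec_0.IH)
next
  case (PrimRec_Suc f g m xs y w)
  from PrimRec_Suc.prems show ?case
  proof (rule computes_PrimRec_SucE)
    fix y'
    assume "computes (PrimRec f g) (m # xs) y'" and g: "computes g (m # y' # xs) z"
    then have "y = y'" by (blast intro: PrimRec_Suc.IH(1))
    with g show "w = z" by (simp add: PrimRec_Suc.IH(2))
  qed
next
  case (Mu f m xs)
  have z: "computes f (z # xs) 0" "\<And>i. i < z \<Longrightarrow> \<exists>y. computes f (i # xs) (Suc y)"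
    by (rule computes_MuE[OF Mu.prems], assumption)+
  show ?case
  proof (rule linorder_cases)
    assume "m < z"
    then obtain y where "computes f (m # xs) (Suc y)" using z(2) by blast
    then show ?thesis using Mu.IH(1) by blast
  next
    assume "z < m"
    then show ?thesis using Mu.IH(2) z(1) by blast
  qed
qed

text \<open>
  A class of presentations is a promise: nothing is required of the algorithm, not even
  termination, on inputs outside the class.
\<close>

definition solves_identity_problem :: "recf \<Rightarrow> (presentation \<Rightarrow> bool) \<Rightarrow> bool" where
  "solves_identity_problem f \<C> \<longleftrightarrow>
     (\<forall>n As X Y. \<C> (n, As) \<longrightarrow> X \<in> words (n, As) \<longrightarrow> Y \<in> words (n, As) \<longrightarrow>
        computes f [n, list_encode (map list_encode As), list_encode X, list_encode Y]
          (if eq_in (n, As) X Y then 1 else 0))"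

end

(*
Adian's reduction to the group of units, following Zhang. Every relator is a product of minimal
invertible words, its pieces. Rewriting the relators over the classes of pieces gives a
presentation with as many relators, none of them longer, and it presents a group: a cyclic
conjugate of a product of units equal to 1 is again equal to 1. Inserting or deleting a relator in
a product of words equal to pieces either acts on whole factors or takes place inside one factor,
whose class it does not change, so two such products are equal in the monoid iff their images are
equal in this group. Replacing a product of short factors by an equal, length-lexicographically
smaller one is then a decidable rewriting rule; invertible words overlap only in invertible words,
so the rewriting system is confluent and equality of normal forms decides the identity problem.

This works presentation by presentation. For fixed k and l only finitely many presentations remain
after renaming the letters in the order of their first occurrence, so one algorithm treats them
all.
*)
theory Submission
  imports Defs
begin

text \<open>Equal products may have different factors: inserting a relator strictly inside a factor
  turns it into another minimal word. There may be infinitely many of them, while a program can only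
  search a finite table. The rewriting rules therefore use those of length at most \<open>l\<close>:
  relators factor into them, and since a replacement that is smaller in length-lexicographic order
  is never longer, a factor changed from inside stays within the bound. So the cutoff does not
  destroy confluence. The argument gives no procedure that finds the pieces and their classes from a
  presentation. For one presentation they are finitely many data whose mere existence fixes a
  program, and the group solver then answers every question about products of factors. This is why
  the final algorithm is assembled from finitely many presentations, and why the letters of the
  relators have to be bounded in terms of \<open>k\<close> and \<open>l\<close> alone.\<close>

section \<open>Computable functions between encoded types\<close>

text \<open>
  Encodings are bijective because a primitive recursion also visits the numbers below its argument,
  so every number has to decode to something.
\<close>

class encodable =
  fixes enc :: "'a \<Rightarrow> nat"
  assumes bij_enc: "bij enc"

instantiation nat :: encodable
begin
definition enc_nat :: "nat \<Rightarrow> nat" where "enc_nat n = n"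
instance by standard (simp add: enc_nat_def[abs_def] bij_id[unfolded id_def])
end

instantiation prod :: (encodable, encodable) encodable
begin
definition enc_prod :: "'a \<times> 'b \<Rightarrow> nat" where
  "enc_prod = prod_encode \<circ> map_prod enc enc"
instance
proof
  have "bij (map_prod enc enc :: 'a \<times> 'b \<Rightarrow> nat \<times> nat)"
    using bij_enc[where ?'a = 'a] bij_enc[where ?'a = 'b]
    by (simp add: bij_def prod.inj_map map_prod_surj)
  then show "bij (enc :: 'a \<times> 'b \<Rightarrow> nat)"
    unfolding enc_prod_def by (rule bij_comp) (rule bij_prod_encode)
qed
end

instantiation list :: (encodable) encodable
begin
definition enc_list :: "'a list \<Rightarrow> nat" where
  "enc_list = list_encode \<circ> map enc"
instance
proof
  have "bij (map enc :: 'a list \<Rightarrow> nat list)"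
    by (rule o_bij[of "map (inv enc)"])
      (simp_all add: bij_enc bij_is_inj bij_is_surj surj_iff[THEN iffD1])
  then show "bij (enc :: 'a list \<Rightarrow> nat)"
    unfolding enc_list_def by (rule bij_comp) (rule bij_list_encode)
qed
end

lemma enc_nat [simp]: "enc (n :: nat) = n"
  by (simp add: enc_nat_def)

lemma enc_Pair [simp]: "enc (x, y) = prod_encode (enc x, enc y)"
  by (simp add: enc_prod_def)

lemma enc_Nil [simp]: "enc [] = 0"
  by (simp add: enc_list_def)

lemma enc_Cons [simp]: "enc (x # xs) = Suc (enc (x, xs))"
  by (simp add: enc_list_def)

lemma enc_nat_list: "enc (w :: nat list) = list_encode w"
  by (simp add: enc_list_def enc_nat_def[abs_def])

lemma enc_nat_list_list: "enc (ws :: nat list list) = list_encode (map list_encode ws)"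
  by (simp add: enc_list_def[where ?'a = "nat list"] enc_nat_list cong: map_cong)

definition dec :: "nat \<Rightarrow> 'a :: encodable" where "dec = inv enc"

lemma dec_enc [simp]: "dec (enc x) = x"
  unfolding dec_def by (rule inv_f_f) (rule bij_is_inj[OF bij_enc])

lemma enc_dec [simp]: "enc (dec n) = n"
  unfolding dec_def by (rule surj_f_inv_f) (rule bij_is_surj[OF bij_enc])

lemma enc_eq_iff [simp]: "enc x = enc y \<longleftrightarrow> x = y"
  by (metis dec_enc)

definition computable :: "('a :: encodable \<Rightarrow> 'b :: encodable) \<Rightarrow> bool" where
  "computable F \<longleftrightarrow> (\<exists>r. \<forall>x. computes r [enc x] (enc (F x)))"

lemma computes_Proj: "i < length xs \<Longrightarrow> y = xs ! i \<Longrightarrow> computes (Proj i) xs y"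
  by (simp add: computes.Proj)

lemma computes_Comp1: "computes g xs y \<Longrightarrow> computes f [y] z \<Longrightarrow> computes (Comp f [g]) xs z"
  by (rule computes.Comp[of _ _ "[y]"]) auto

lemma computes_Comp2:
  "computes g xs y \<Longrightarrow> computes h xs y' \<Longrightarrow> computes f [y, y'] z \<Longrightarrow> computes (Comp f [g, h]) xs z"
  by (rule computes.Comp[of _ _ "[y, y']"]) auto

lemma computes_PrimRec:
  assumes "computes f xs b" and "\<And>m y. computes g (m # y # xs) (s m y)"
  shows "computes (PrimRec f g) (n # xs) (rec_nat b s n)"
  by (induction n) (auto intro: computes.intros assms)

section \<open>Arithmetic and Cantor pairing as recursive functions\<close>

definition add_rec :: recf where "add_rec = PrimRec (Proj 0) (Comp Succ [Proj 1])"
definition triangle_rec :: recf where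
  "triangle_rec = PrimRec Zero (Comp Succ [Comp add_rec [Proj 1, Proj 0]])"
definition pair_rec :: recf where
  "pair_rec = Comp add_rec [Comp triangle_rec [add_rec], Proj 0]"
definition pred_rec :: recf where "pred_rec = PrimRec Zero (Proj 0)"
text \<open>The subtrahend is the first argument, because the recursion variable comes
  first.\<close>

definition sub_rec :: recf where "sub_rec = PrimRec (Proj 0) (Comp pred_rec [Proj 1])"
text \<open>The codes of the pairs with sum \<open>s\<close> fill the numbers from
  \<open>triangle s\<close> up to, but excluding, \<open>triangle (Suc s)\<close>. The search stops
  at the first \<open>s\<close> for which the code is below \<open>triangle (Suc s)\<close>, where
  the truncated difference becomes 0.\<close>

definition diagonal_rec :: recf where
  "diagonal_rec = Mu (Comp sub_rec [Comp triangle_rec [Comp Succ [Proj 0]], Comp Succ [Proj 1]])"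
definition fst_rec :: recf where
  "fst_rec = Comp sub_rec [Comp triangle_rec [diagonal_rec], Proj 0]"
definition snd_rec :: recf where "snd_rec = Comp sub_rec [fst_rec, diagonal_rec]"

lemma computes_add: "computes add_rec [m, n] (m + n)"
proof -
  have "computes add_rec [m, n] (rec_nat n (\<lambda>_. Suc) m)"
    unfolding add_rec_def
    by (rule computes_PrimRec)
      (auto intro!: computes.Succ computes_Comp1 computes_Proj simp del: One_nat_def)
  also have "rec_nat n (\<lambda>_. Suc) m = m + n"
    by (induction m) auto
  finally show ?thesis .
qed

lemma computes_triangle: "computes triangle_rec [n] (triangle n)"
proof -
  have "computes triangle_rec [n] (rec_nat 0 (\<lambda>m y. Suc (y + m)) n)"
    unfolding triangle_rec_def
    by (rule computes_PrimRec)
      (auto intro!: computes.Zero computes.Succ computes_Comp1 computes_Comp2 computes_add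
        computes_Proj simp del: One_nat_def)
  also have "rec_nat 0 (\<lambda>m y. Suc (y + m)) n = triangle n"
    by (induction n) auto
  finally show ?thesis .
qed

lemma computes_pair: "computes pair_rec [m, n] (prod_encode (m, n))"
  unfolding pair_rec_def prod_encode_def
  by (auto intro!: computes_Comp1 computes_Comp2 computes_add computes_triangle computes_Proj)

lemma computes_pred: "computes pred_rec [n] (n - 1)"
proof -
  have "computes pred_rec [n] (rec_nat 0 (\<lambda>m _. m) n)"
    unfolding pred_rec_def
    by (rule computes_PrimRec) (auto intro!: computes.Zero computes_Proj)
  also have "rec_nat 0 (\<lambda>m _. m) n = n - 1"
    by (cases n) auto
  finally show ?thesis .
qed

lemma computes_sub: "computes sub_rec [m, n] (n - m)"
proof -
  have "computes sub_rec [m, n] (rec_nat n (\<lambda>_ y. y - 1) m)"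
    unfolding sub_rec_def
    by (rule computes_PrimRec)
      (auto intro!: computes_pred computes_Comp1 computes_Proj simp del: One_nat_def)
  also have "rec_nat n (\<lambda>_ y. y - 1) m = n - m"
    by (induction m) auto
  finally show ?thesis .
qed

lemma triangle_mono: "m \<le> n \<Longrightarrow> triangle m \<le> triangle n"
  by (induction rule: dec_induct) auto

lemma computes_diagonal: "computes diagonal_rec [prod_encode (m, n)] (m + n)"
proof -
  let ?g = "Comp sub_rec [Comp triangle_rec [Comp Succ [Proj 0]], Comp Succ [Proj 1]]"
  let ?z = "prod_encode (m, n)"
  have g: "computes ?g [s, ?z] (Suc ?z - triangle (Suc s))" for s
    by (auto intro!: computes.Succ computes_Comp1 computes_Comp2 computes_sub computes_triangle
        computes_Proj simp del: One_nat_def triangle_Suc)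
  show ?thesis
    unfolding diagonal_rec_def
  proof (rule computes.Mu)
    show "computes ?g [m + n, ?z] 0"
      using g[of "m + n"] by (simp add: prod_encode_def)
  next
    fix i assume "i < m + n"
    then have "triangle (Suc i) \<le> ?z"
      using triangle_mono[of "Suc i" "m + n"] by (simp add: prod_encode_def)
    then have "Suc ?z - triangle (Suc i) = Suc (?z - triangle (Suc i))"
      by (simp add: Suc_diff_le)
    then show "\<exists>y. computes ?g [i, ?z] (Suc y)"
      using g[of i] by metis
  qed
qed

lemma computes_fst: "computes fst_rec [prod_encode (m, n)] m"
proof -
  have "computes fst_rec [prod_encode (m, n)] (prod_encode (m, n) - triangle (m + n))"
    unfolding fst_rec_def
    by (rule computes_Comp2[OF computes_Comp1[OF computes_diagonal computes_triangle] _ computes_sub])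
      (simp add: computes_Proj)
  then show ?thesis
    by (simp add: prod_encode_def)
qed

lemma computes_snd: "computes snd_rec [prod_encode (m, n)] n"
  using computes_Comp2[OF computes_fst computes_diagonal computes_sub, of m n]
  by (simp add: snd_rec_def)

section \<open>Closure properties of computable functions and decidable predicates\<close>

named_theorems computable_intros

lemma computable_id [computable_intros]: "computable (\<lambda>x. x)"
  unfolding computable_def by (auto intro!: exI[of _ "Proj 0"] computes_Proj)

lemma computable_comp:
  assumes "computable F" "computable G"
  shows "computable (\<lambda>x. F (G x))"
  using assms unfolding computable_def by (meson computes_Comp1)

lemma computable_enc:
  assumes "computable G"
  shows "computable (\<lambda>x. enc (G x))"
  using assms unfolding computable_def by simp

lemma computable_dec:
  assumes "computable G"
  shows "computable (\<lambda>x. dec (G x))"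
  using assms unfolding computable_def by simp

lemma computable_Suc [computable_intros]:
  assumes "computable G"
  shows "computable (\<lambda>x. Suc (G x))"
  using assms unfolding computable_def enc_nat by (meson computes_Comp1 computes.Succ)

lemma computable_const [computable_intros]: "computable (\<lambda>x. c)"
proof -
  have "\<exists>r. \<forall>xs. computes r xs n" for n
  proof (induction n)
    case 0
    then show ?case using computes.Zero by blast
  next
    case (Suc n)
    then show ?case using computes_Comp1[OF _ computes.Succ] by blast
  qed
  then show ?thesis unfolding computable_def by blast
qed

lemma computable_Pair [computable_intros]:
  assumes "computable F" "computable G"
  shows "computable (\<lambda>x. (F x, G x))"
  using assms unfolding computable_def enc_Pair by (meson computes_Comp2 computes_pair)

lemma computable_fst [computable_intros]:
  fixes F :: "'c :: encodable \<Rightarrow> 'a :: encodable \<times> 'b :: encodable"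
  assumes "computable F"
  shows "computable (\<lambda>x. fst (F x))"
proof (rule computable_comp[OF _ assms])
  show "computable (fst :: 'a \<times> 'b \<Rightarrow> 'a)"
    by (auto simp: computable_def intro!: exI[of _ fst_rec] computes_fst)
qed

lemma computable_snd [computable_intros]:
  fixes F :: "'c :: encodable \<Rightarrow> 'a :: encodable \<times> 'b :: encodable"
  assumes "computable F"
  shows "computable (\<lambda>x. snd (F x))"
proof (rule computable_comp[OF _ assms])
  show "computable (snd :: 'a \<times> 'b \<Rightarrow> 'b)"
    by (auto simp: computable_def intro!: exI[of _ snd_rec] computes_snd)
qed

lemma computable_rec_nat [computable_intros]:
  assumes "computable b"
    and "computable (\<lambda>p. s (fst p) (fst (snd p)) (snd (snd p)))"
    and "computable n"
  shows "computable (\<lambda>x. rec_nat (b x) (\<lambda>i y. s x i y) (n x))"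
proof -
  obtain rb where rb: "computes rb [enc x] (enc (b x))" for x
    using assms(1) unfolding computable_def by blast
  obtain rs where rs: "computes rs [enc (x, i, y)] (enc (s x i y))" for x i y
    using assms(2) unfolding computable_def by force
  obtain rn where rn: "computes rn [enc x] (n x)" for x
    using assms(3) unfolding computable_def by auto
  \<comment> \<open>\<open>PrimRec\<close> passes the counter, the accumulator and the context in
    this order, while \<open>rs\<close> expects the code of a triple with the context in
    front.\<close>
  let ?g = "Comp rs [Comp pair_rec [Proj 2, Comp pair_rec [Proj 0, Proj 1]]]"
  have g: "computes ?g [i, enc y, enc x] (enc (s x i y))" for i x y
    by (rule computes_Comp1[OF _ rs])
      (auto intro!: computes_Comp2[OF _ _ computes_pair] computes_Proj simp del: One_nat_def)
  have "computes (PrimRec rb ?g) [m, enc x] (enc (rec_nat (b x) (s x) m))" for m x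
    by (induction m) (auto intro!: computes.PrimRec_0 computes.PrimRec_Suc rb g simp del: One_nat_def enc_Pair)
  then have "computes (Comp (PrimRec rb ?g) [rn, Proj 0]) [enc x] (enc (rec_nat (b x) (s x) (n x)))"
    for x
    by (auto intro!: computes_Comp2[OF rn] computes_Proj)
  then show ?thesis unfolding computable_def by blast
qed

lemma computable_add [computable_intros]:
  assumes "computable F" "computable G"
  shows "computable (\<lambda>x. F x + G x :: nat)"
proof -
  have "n + m = rec_nat m (\<lambda>_. Suc) n" for n m :: nat
    by (induction n) auto
  then show ?thesis by (auto intro!: computable_intros assms[THEN computable_comp])
qed

lemma computable_mult [computable_intros]:
  assumes "computable F" "computable G"
  shows "computable (\<lambda>x. F x * G x :: nat)"
proof -
  have "n * m = rec_nat 0 (\<lambda>_ y. m + y) n" for n m :: nat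
    by (induction n) auto
  then show ?thesis by (auto intro!: computable_intros assms[THEN computable_comp])
qed

lemma computable_diff [computable_intros]:
  assumes "computable F" "computable G"
  shows "computable (\<lambda>x. F x - G x :: nat)"
proof -
  have pred: "n - 1 = rec_nat 0 (\<lambda>i _. i) n" for n :: nat
    by (cases n) auto
  have "n - m = rec_nat n (\<lambda>_ y. y - 1) m" for n m :: nat
    by (induction m) auto
  then show ?thesis unfolding pred by (auto intro!: computable_intros assms[THEN computable_comp])
qed

definition decidable :: "('a :: encodable \<Rightarrow> bool) \<Rightarrow> bool" where
  "decidable P \<longleftrightarrow> computable (\<lambda>x. of_bool (P x) :: nat)"

text \<open>The truth value serves as the number of recursion rounds, 0 or 1.\<close>

lemma computable_If [computable_intros]:
  assumes "decidable P" "computable F" "computable G"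
  shows "computable (\<lambda>x. if P x then F x else G x)"
proof -
  have "(if P x then F x else G x) = rec_nat (G x) (\<lambda>_ _. F x) (of_bool (P x))" for x
    by simp
  then show ?thesis using assms unfolding decidable_def
    by (auto intro!: computable_intros intro: computable_comp)
qed

lemma decidable_not [computable_intros]:
  assumes "decidable P"
  shows "decidable (\<lambda>x. \<not> P x)"
proof -
  have "of_bool (\<not> P x) = (1 - of_bool (P x) :: nat)" for x
    by simp
  then show ?thesis using assms unfolding decidable_def by (auto intro!: computable_intros)
qed

lemma decidable_conj [computable_intros]:
  "decidable P \<Longrightarrow> decidable Q \<Longrightarrow> decidable (\<lambda>x. P x \<and> Q x)"
  unfolding decidable_def of_bool_conj by (auto intro!: computable_intros)

lemma decidable_less [computable_intros]:
  assumes "computable F" "computable G"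
  shows "decidable (\<lambda>x. F x < (G x :: nat))"
proof -
  have "of_bool (F x < G x) = (1 - (1 - (G x - F x)) :: nat)" for x
    by auto
  then show ?thesis unfolding decidable_def
    by (auto intro!: computable_intros assms[THEN computable_comp])
qed

lemma decidable_eq [computable_intros]:
  assumes "computable F" "computable G"
  shows "decidable (\<lambda>x. F x = G x)"
proof -
  have "F x = G x \<longleftrightarrow> \<not> enc (F x) < enc (G x) \<and> \<not> enc (G x) < enc (F x)" for x
    using enc_eq_iff[of "F x" "G x"] by linarith
  then show ?thesis by (auto intro!: computable_intros computable_enc assms[THEN computable_comp])
qed

lemma decidable_comp: "decidable P \<Longrightarrow> computable F \<Longrightarrow> decidable (\<lambda>x. P (F x))"
  unfolding decidable_def by (rule computable_comp)

lemma computable_Cons [computable_intros]: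
  assumes "computable F" "computable G"
  shows "computable (\<lambda>x. F x # G x)"
proof -
  have *: "F x # G x = dec (Suc (enc (F x, G x)))" for x
    by (metis dec_enc enc_Cons)
  show ?thesis unfolding * by (intro computable_intros computable_enc computable_dec assms)
qed

text \<open>The predecessor of the code of a nonempty list is the code of the pair of its head and
  tail. In a recursion over the code of the list, which ignores its accumulator, this predecessor is
  the last value of the counter.\<close>

lemma computable_case_list [computable_intros]:
  fixes L :: "'a :: encodable \<Rightarrow> 'b :: encodable list" and F :: "'a \<Rightarrow> 'c :: encodable"
  assumes "computable L" "computable F"
    and "computable (\<lambda>p. G (fst p) (fst (snd p)) (snd (snd p)))"
  shows "computable (\<lambda>x. case L x of [] \<Rightarrow> F x | a # as \<Rightarrow> G x a as)"
proof -
  have "(case L x of [] \<Rightarrow> F x | a # as \<Rightarrow> G x a as) =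
    rec_nat (F x) (\<lambda>m _. (\<lambda>q. G x (fst q) (snd q)) (dec m)) (enc (L x))" for x
    by (cases "L x") (auto simp del: enc_Pair)
  moreover have "computable (\<lambda>p :: 'a \<times> nat \<times> 'c. (\<lambda>q. G (fst p) (fst q) (snd q)) (dec (fst (snd p))))"
    using computable_comp[OF assms(3), of "\<lambda>p. (fst p, dec (fst (snd p)))"]
    by (simp add: computable_intros computable_dec)
  ultimately show ?thesis
    by (auto intro!: computable_intros computable_enc assms[THEN computable_comp])
qed

lemma length_le_enc: "length xs \<le> enc xs"
  by (induction xs) (auto intro: order.trans[OF _ le_prod_encode_2])

text \<open>The state is the accumulator together with the unread rest of the list. The code of the
  list bounds its length, and surplus rounds leave a state with nothing unread unchanged.\<close>

lemma computable_foldl [computable_intros]: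
  assumes "computable b" "computable L"
    and "computable (\<lambda>p. s (fst p) (fst (snd p)) (snd (snd p)))"
  shows "computable (\<lambda>x. foldl (\<lambda>acc a. s x acc a) (b x) (L x))"
proof -
  let ?f = "\<lambda>x st. case snd st of [] \<Rightarrow> st | a # as \<Rightarrow> (s x (fst st) a, as)"
  have iter: "fst (rec_nat (acc, as) (\<lambda>_. ?f x) n) = foldl (s x) acc as"
    if "length as \<le> n" for x acc as n
  proof -
    have "rec_nat (acc, as) (\<lambda>_. ?f x) n = (foldl (s x) acc (take n as), drop n as)" for n
    proof (induction n)
      case (Suc n)
      show ?case
      proof (cases "n < length as")
        case True
        then show ?thesis by (simp add: Suc take_Suc_conv_app_nth Cons_nth_drop_Suc[symmetric])
      qed (simp add: Suc)
    qed simp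
    with that show ?thesis by simp
  qed
  note * = computable_comp[OF assms(3), of "\<lambda>p. (fst (fst p), fst (snd (snd (fst p))), fst (snd p))", simplified]
  have "foldl (s x) (b x) (L x) = fst (rec_nat (b x, L x) (\<lambda>_. ?f x) (enc (L x)))" for x
    by (rule iter[symmetric]) (rule length_le_enc)
  then show ?thesis by (auto intro!: computable_intros computable_enc assms *)
qed

lemma computable_length [computable_intros]:
  assumes "computable L"
  shows "computable (\<lambda>x. length (L x))"
proof -
  have "foldl (\<lambda>n _. Suc n) m xs = m + length xs" for m and xs :: "'b list"
    by (induction xs arbitrary: m) auto
  from this[of 0] have *: "length xs = foldl (\<lambda>n _. Suc n) 0 xs" for xs :: "'b list"
    by simp
  show ?thesis unfolding * by (intro computable_intros assms)
qed

lemma computable_rev [computable_intros]: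
  assumes "computable L"
  shows "computable (\<lambda>x. rev (L x))"
proof -
  have *: "rev xs = foldl (\<lambda>acc a. a # acc) [] xs" for xs :: "'b list"
    by (simp add: foldl_conv_fold rev_conv_fold)
  show ?thesis unfolding * by (intro computable_intros assms)
qed

lemma computable_append [computable_intros]:
  assumes "computable F" "computable G"
  shows "computable (\<lambda>x. F x @ G x)"
proof -
  have *: "xs @ ys = foldl (\<lambda>acc a. a # acc) ys (rev xs)" for xs ys :: "'b list"
    by (simp add: foldl_conv_fold fold_Cons_rev)
  show ?thesis unfolding * by (intro computable_intros assms)
qed

lemma computable_concat [computable_intros]:
  assumes "computable F"
  shows "computable (\<lambda>x. concat (F x))"
proof -
  have "foldl (@) ys xss = ys @ concat xss" for ys :: "'b list" and xss
    by (induction xss arbitrary: ys) auto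
  from this[of "[]"] have *: "concat xss = foldl (@) [] xss" for xss :: "'b list list"
    by simp
  show ?thesis unfolding * by (intro computable_intros assms)
qed

lemma computable_map [computable_intros]:
  assumes "computable (\<lambda>p. f (fst p) (snd p))" "computable L"
  shows "computable (\<lambda>x. map (f x) (L x))"
proof -
  have "foldl (\<lambda>acc a. acc @ [g a]) as xs = as @ map g xs" for g :: "'b \<Rightarrow> 'c" and as xs
    by (induction xs arbitrary: as) auto
  from this[of _ "[]"] have "map (f x) (L x) = foldl (\<lambda>acc a. acc @ [f x a]) [] (L x)" for x
    by simp
  moreover have "computable (\<lambda>p. f (fst p) (snd (snd p)))"
    using assms(1)[THEN computable_comp, of "\<lambda>p. (fst p, snd (snd p))"]
    by (simp add: computable_intros)
  ultimately show ?thesis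
    by (auto intro!: computable_intros assms)
qed

lemma computable_filter [computable_intros]:
  assumes "decidable (\<lambda>p. P (fst p) (snd p))" "computable L"
  shows "computable (\<lambda>x. filter (P x) (L x))"
proof -
  have "foldl (\<lambda>acc a. if Q a then acc @ [a] else acc) as xs = as @ filter Q xs" for Q :: "'b \<Rightarrow> bool" and as xs
    by (induction xs arbitrary: as) auto
  from this[of _ "[]"]
  have "filter (P x) (L x) = foldl (\<lambda>acc a. if P x a then acc @ [a] else acc) [] (L x)" for x
    by simp
  moreover have "decidable (\<lambda>p. P (fst p) (snd (snd p)))"
    using assms(1)[THEN decidable_comp, of "\<lambda>p. (fst p, snd (snd p))"]
    by (simp add: computable_intros)
  ultimately show ?thesis
    by (auto intro!: computable_intros assms)
qed

lemma computable_tl [computable_intros]: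
  assumes "computable F"
  shows "computable (\<lambda>x. tl (F x))"
  unfolding tl_def by (intro computable_intros assms)

lemma computable_drop [computable_intros]:
  assumes "computable n" "computable L"
  shows "computable (\<lambda>x. drop (n x) (L x))"
proof -
  have *: "drop n xs = rec_nat xs (\<lambda>_. tl) n" for n and xs :: "'b list"
    by (induction n) (simp, metis drop_Suc old.nat.simps(7) tl_drop)
  show ?thesis unfolding * by (intro computable_intros assms)
qed

lemma computable_take [computable_intros]:
  assumes "computable n" "computable L"
  shows "computable (\<lambda>x. take (n x) (L x))"
proof -
  have *: "take n xs = rev (drop (length xs - n) (rev xs))" for n and xs :: "'b list"
    by (cases "n \<le> length xs") (simp_all add: rev_drop)
  show ?thesis unfolding * by (intro computable_intros assms)
qed

lemma computable_upt [computable_intros]: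
  assumes "computable n"
  shows "computable (\<lambda>x. [0..<n x])"
proof -
  have *: "[0..<n] = rec_nat [] (\<lambda>i is. is @ [i]) n" for n
    by (induction n) auto
  show ?thesis unfolding * by (intro computable_intros assms)
qed

text \<open>The functions \<open>F s\<close> may have nothing in common: their programs are joined
  by finitely many equality tests, so it is enough that each of them exists.\<close>

lemma computable_finite_cases:
  assumes "finite S" "\<And>s. s \<in> S \<Longrightarrow> computable (F s)"
  shows "\<exists>G. computable G \<and> (\<forall>s \<in> S. \<forall>x. G (s, x) = F s x)"
  using assms
proof (induction S rule: finite_induct)
  case empty
  have "computable (\<lambda>_ :: 'a \<times> 'b. undefined :: 'c)"
    by (rule computable_const)
  then show ?case by (intro exI[of _ "\<lambda>_. undefined"]) simp
next
  case (insert s S)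
  obtain G where G: "computable G" "\<forall>s \<in> S. \<forall>x. G (s, x) = F s x"
    using insert.IH[OF insert.prems[OF insertI2]] by auto
  let ?G = "\<lambda>p. if fst p = s then F s (snd p) else G p"
  have "computable (F s)"
    by (rule insert.prems) simp
  then have "computable ?G"
    by (intro computable_intros G computable_comp[of "F s" snd])
  moreover have "\<forall>s' \<in> insert s S. \<forall>x. ?G (s', x) = F s' x"
    using G(2) by simp
  ultimately show ?case by (intro exI[of _ ?G] conjI)
qed

section \<open>Monoids with relations of the form \<open>A = 1\<close>\<close>

lemma eq_in_refl [simp]: "eq_in \<Pi> X X"
  by (simp add: eq_in_def equivclp_def)

lemma eq_in_sym: "eq_in \<Pi> X Y \<Longrightarrow> eq_in \<Pi> Y X"
  unfolding eq_in_def by (rule equivclp_sym)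

lemma eq_in_trans [trans]: "eq_in \<Pi> X Y \<Longrightarrow> eq_in \<Pi> Y Z \<Longrightarrow> eq_in \<Pi> X Z"
  unfolding eq_in_def by (rule equivclp_trans)

lemma eq_in_relator: "A \<in> set (snd \<Pi>) \<Longrightarrow> eq_in \<Pi> A []"
  unfolding eq_in_def
  by (rule equivclp_sym, rule r_into_equivclp) (force simp: insertion_def)

text \<open>Equality is generated by single insertions, so a map of words respects it as soon as it
  respects the deletion of one relator. Contexts, substitutions and the count of foreign letters are
  instances.\<close>

lemma eq_in_preserved:
  assumes "eq_in \<Pi> X Y" and "\<And>U A V. A \<in> set (snd \<Pi>) \<Longrightarrow> eq_in \<Pi>' (h (U @ A @ V)) (h (U @ V))"
  shows "eq_in \<Pi>' (h X) (h Y)"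
  using assms(1) unfolding eq_in_def[of \<Pi>]
proof (induction rule: equivclp_induct)
  case (step Y Z)
  then have "eq_in \<Pi>' (h Y) (h Z)"
    using assms(2) by (auto simp: insertion_def intro: eq_in_sym[of \<Pi>'])
  with step.IH show ?case by (rule eq_in_trans)
qed simp

lemma eq_in_context:
  assumes "eq_in \<Pi> X Y"
  shows "eq_in \<Pi> (U @ X @ V) (U @ Y @ V)"
  using assms
proof (rule eq_in_preserved[where h = "\<lambda>X. U @ X @ V"])
  fix U' A V' assume A: "A \<in> set (snd \<Pi>)"
  show "eq_in \<Pi> (U @ (U' @ A @ V') @ V) (U @ (U' @ V') @ V)"
    unfolding eq_in_def insertion_def
    by (rule equivclp_sym, rule r_into_equivclp, rule exI[of _ "U @ U'"]) (use A in auto)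
qed

lemma eq_in_append: "eq_in \<Pi> X X' \<Longrightarrow> eq_in \<Pi> Y Y' \<Longrightarrow> eq_in \<Pi> (X @ Y) (X' @ Y')"
  using eq_in_context[of \<Pi> X X' "[]" Y] eq_in_context[of \<Pi> Y Y' X' "[]"]
  by (auto intro: eq_in_trans)

lemma eq_in_hom:
  assumes "eq_in (n, As) X Y" and "\<And>A. A \<in> set As \<Longrightarrow> eq_in \<Pi> (concat (map \<sigma> A)) []"
  shows "eq_in \<Pi> (concat (map \<sigma> X)) (concat (map \<sigma> Y))"
  using assms(1)
  by (rule eq_in_preserved[where h = "\<lambda>X. concat (map \<sigma> X)"])
    (use eq_in_context[OF assms(2)] in force)

lemma eq_in_rename:
  assumes "eq_in (n, As) X Y"
  shows "eq_in (m, map (map \<rho>) As) (map \<rho> X) (map \<rho> Y)"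
proof -
  have "concat (map (\<lambda>x. [\<rho> x]) X) = map \<rho> X" for X
    by (induction X) auto
  then show ?thesis
    using eq_in_hom[OF assms, of "(m, map (map \<rho>) As)" "\<lambda>x. [\<rho> x]"] by (simp add: eq_in_relator)
qed

lemma two_sided_invertible_append:
  assumes "two_sided_invertible \<Pi> X" "two_sided_invertible \<Pi> X'"
  shows "two_sided_invertible \<Pi> (X @ X')"
proof -
  from assms obtain Y Z Y' Z' where *: "Y \<in> words \<Pi>" "Z \<in> words \<Pi>" "Y' \<in> words \<Pi>" "Z' \<in> words \<Pi>"
    "eq_in \<Pi> (Y @ X) []" "eq_in \<Pi> (X @ Z) []" "eq_in \<Pi> (Y' @ X') []" "eq_in \<Pi> (X' @ Z') []"
    unfolding two_sided_invertible_def by blast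
  have "eq_in \<Pi> ((Y' @ Y) @ X @ X') []"
    using eq_in_trans[OF eq_in_context[OF *(5), of Y' X']] * by simp
  moreover have "eq_in \<Pi> ((X @ X') @ Z' @ Z) []"
    using eq_in_trans[OF eq_in_context[OF *(8), of X Z]] * by simp
  ultimately show ?thesis
    using * unfolding two_sided_invertible_def words_def by (metis append_in_lists_conv)
qed

text \<open>
  The number of letters does not enter \<open>eq_in\<close>, hence the dummy \<open>0\<close> in its argument below; all words
  over the natural numbers are admitted.
\<close>

locale special_monoid =
  fixes R :: "word list"
begin

section \<open>Invertible words and minimal invertible words\<close>

abbreviation eqv (infix "\<approx>" 50) where "u \<approx> v \<equiv> eq_in (0, R) u v"

definition linv :: "word \<Rightarrow> bool" where "linv u \<longleftrightarrow> (\<exists>y. y @ u \<approx> [])"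
definition rinv :: "word \<Rightarrow> bool" where "rinv u \<longleftrightarrow> (\<exists>z. u @ z \<approx> [])"
definition invertibles :: "word set" where "invertibles = {u. linv u \<and> rinv u}"

lemma eqv_left: "u \<approx> v \<Longrightarrow> a @ u \<approx> a @ v"
  using eq_in_context[of _ u v a "[]"] by simp

lemma eqv_right: "u \<approx> v \<Longrightarrow> u @ b \<approx> v @ b"
  using eq_in_context[of _ u v "[]" b] by simp

lemma linv_suffix: "linv (a @ b) \<Longrightarrow> linv b"
  unfolding linv_def by (metis append.assoc)

lemma rinv_prefix: "rinv (a @ b) \<Longrightarrow> rinv a"
  unfolding rinv_def by (metis append.assoc)

lemma linv_cancel:
  assumes "linv a" "a @ u \<approx> a @ v"
  shows "u \<approx> v"
proof -
  from assms(1) obtain y where y: "y @ a \<approx> []" unfolding linv_def ..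
  have "u \<approx> y @ a @ u" using eqv_right[OF y, of u] by (simp add: eq_in_sym)
  also have "y @ a @ u \<approx> y @ a @ v" using assms(2) by (rule eqv_left)
  also have "y @ a @ v \<approx> v" using eqv_right[OF y, of v] by simp
  finally show ?thesis .
qed

lemma rinv_cancel:
  assumes "rinv a" "u @ a \<approx> v @ a"
  shows "u \<approx> v"
proof -
  from assms(1) obtain z where z: "a @ z \<approx> []" unfolding rinv_def ..
  have "u \<approx> (u @ a) @ z" using eqv_left[OF z, of u] by (simp add: eq_in_sym)
  also have "(u @ a) @ z \<approx> (v @ a) @ z" using assms(2) by (rule eqv_right)
  also have "(v @ a) @ z \<approx> v" using eqv_left[OF z, of v] by simp
  finally show ?thesis .
qed

text \<open>Multiplying by \<open>a\<close> on the right gives \<open>a x a = a\<close>, and the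
  first \<open>a\<close> may be cancelled.\<close>

lemma conjugate_eq_Nil: 
  assumes "a @ x \<approx> []" "linv a"
  shows "x @ a \<approx> []"
  using linv_cancel[OF assms(2), of "x @ a" "[]"] eqv_right[OF assms(1), of a] by simp

lemma invertibles_Nil [simp]: "[] \<in> invertibles"
  unfolding invertibles_def linv_def rinv_def using eq_in_refl
  by (metis (mono_tags) append_Nil mem_Collect_eq)

lemma invertibles_append:
  assumes "a \<in> invertibles" "b \<in> invertibles"
  shows "a @ b \<in> invertibles"
proof -
  from assms obtain y z y' z' where *: "y @ a \<approx> []" "a @ z \<approx> []" "y' @ b \<approx> []" "b @ z' \<approx> []"
    unfolding invertibles_def linv_def rinv_def by blast
  have "(y' @ y) @ a @ b \<approx> []"
    using eq_in_trans[OF eq_in_context[OF *(1), of y' b]] * by simp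
  moreover have "(a @ b) @ z' @ z \<approx> []"
    using eq_in_trans[OF eq_in_context[OF *(4), of a z]] * by simp
  ultimately show ?thesis unfolding invertibles_def linv_def rinv_def by blast
qed

lemma invertibles_eqv:
  assumes "a \<in> invertibles" "a \<approx> b"
  shows "b \<in> invertibles"
  using assms unfolding invertibles_def linv_def rinv_def
  by (auto intro: eq_in_trans[OF eqv_left[OF eq_in_sym]] eq_in_trans[OF eqv_right[OF eq_in_sym]])

text \<open>As a suffix, \<open>b\<close> is left invertible; a right inverse of the product,
  followed by \<open>a\<close>, is a right inverse of \<open>b\<close>.\<close>

lemma invertibles_cancel_left:
  assumes "a @ b \<in> invertibles" "a \<in> invertibles"
  shows "b \<in> invertibles"
proof -
  from assms obtain z where z: "a @ b @ z \<approx> []" and "linv a" "linv b"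
    using linv_suffix unfolding invertibles_def rinv_def by auto
  then have "b @ z @ a \<approx> []"
    using conjugate_eq_Nil[OF z] by simp
  with \<open>linv b\<close> show ?thesis unfolding invertibles_def rinv_def by blast
qed

lemma invertibles_cancel_right:
  assumes "a @ b \<in> invertibles" "b \<in> invertibles"
  shows "a \<in> invertibles"
proof -
  from assms obtain y where y: "y @ a @ b \<approx> []" and "rinv b" "rinv a"
    using rinv_prefix unfolding invertibles_def linv_def by auto
  have "(b @ y @ a) @ b \<approx> [] @ b"
    using eqv_left[OF y, of b] by simp
  then have "b @ y @ a \<approx> []"
    using rinv_cancel[OF \<open>rinv b\<close>] by blast
  then have "(b @ y) @ a \<approx> []" by simp
  with \<open>rinv a\<close> show ?thesis unfolding invertibles_def linv_def by blast
qed

text \<open>The overlap is a suffix of one invertible word, hence left invertible, and a prefix of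
  the other, hence right invertible. The outer parts follow by cancellation.\<close>

lemma invertibles_overlap:
  assumes "a @ b \<in> invertibles" "b @ c \<in> invertibles"
  shows "a \<in> invertibles" "b \<in> invertibles" "c \<in> invertibles"
proof -
  show b: "b \<in> invertibles"
    using assms linv_suffix rinv_prefix unfolding invertibles_def by blast
  show "a \<in> invertibles" using assms(1) b by (rule invertibles_cancel_right)
  show "c \<in> invertibles" using assms(2) b by (rule invertibles_cancel_left)
qed

text \<open>Only prefixes are tested; by cancellation, nonempty proper suffixes that are invertible
  are excluded as well. An invertible subword touching neither end is allowed, and this is where a
  relator can occur inside a factor.\<close>

definition minimals :: "word set" where
  "minimals = {p \<in> invertibles. p \<noteq> [] \<and> (\<forall>x y. p = x @ y \<longrightarrow> x \<in> invertibles \<longrightarrow> x = [] \<or> y = [])}"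

lemma minimals_invertibles: "p \<in> minimals \<Longrightarrow> p \<in> invertibles"
  by (simp add: minimals_def)

lemma minimals_prefix: "x @ y \<in> minimals \<Longrightarrow> x \<in> invertibles \<Longrightarrow> x \<noteq> [] \<Longrightarrow> y = []"
  unfolding minimals_def by blast

text \<open>Where would an invertible proper prefix of the new word end? Inside \<open>a\<close>, it
  is also a prefix of the old word; inside \<open>u'\<close>, it overlaps \<open>u'\<close> and
  makes \<open>a\<close> invertible; inside \<open>b\<close>, exchanging \<open>u'\<close> for
  \<open>u\<close> in it gives an invertible prefix of the old word.\<close>

lemma minimals_replace:
  assumes p: "a @ u @ b \<in> minimals" and "a \<noteq> []" "b \<noteq> []" and u: "u \<in> invertibles" "u \<approx> u'"
  shows "a @ u' @ b \<in> minimals"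
proof -
  have u': "u' \<in> invertibles" using invertibles_eqv u by blast
  have *: "a @ u @ v \<approx> a @ u' @ v" for v
    using eq_in_context[OF u(2)] .
  have a: "a \<notin> invertibles" using minimals_prefix[OF p] assms by auto
  have "a @ u' @ b \<in> invertibles"
    using invertibles_eqv[OF minimals_invertibles[OF p] *] .
  moreover have "x = [] \<or> y = []" if xy: "a @ u' @ b = x @ y" and x: "x \<in> invertibles" for x y
  proof (rule ccontr)
    assume ne: "\<not> (x = [] \<or> y = [])"
    from xy consider t where "a = x @ t" | t where "x = a @ t" "u' @ b = t @ y"
      by (auto simp: append_eq_append_conv2)
    then show False
    proof cases
      case 1
      then show False using minimals_prefix[of x "t @ u @ b"] p x ne \<open>b \<noteq> []\<close> by simp
    next
      case 2
      from 2(2) consider s where "u' = t @ s" | s where "t = u' @ s" "b = s @ y"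
        by (auto simp: append_eq_append_conv2)
      then show False
      proof cases
        case 1
        then show False using invertibles_overlap(1)[of a t s] 2 x u' a by simp
      next
        case s: 2
        then have "a @ u @ s \<in> invertibles"
          using invertibles_eqv[OF _ eq_in_sym[OF *]] x 2 by simp
        then show False using minimals_prefix[of "a @ u @ s" y] p s ne \<open>a \<noteq> []\<close> by simp
      qed
    qed
  qed
  ultimately show ?thesis using \<open>a \<noteq> []\<close> unfolding minimals_def by blast
qed

section \<open>Unique factorization of invertible words\<close>

definition star :: "word set \<Rightarrow> word set" where
  "star Q = {concat L |L. set L \<subseteq> Q}"

lemma star_Nil [simp]: "[] \<in> star Q"
  unfolding star_def by (auto intro: exI[of _ "[]"])

lemma star_append: "u \<in> star Q \<Longrightarrow> v \<in> star Q \<Longrightarrow> u @ v \<in> star Q"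
  unfolding star_def by clarsimp (metis concat_append le_sup_iff set_append)

lemma star_singleton: "p \<in> Q \<Longrightarrow> p \<in> star Q"
  unfolding star_def by (auto intro: exI[of _ "[p]"])

lemma star_mono: "Q \<subseteq> Q' \<Longrightarrow> star Q \<subseteq> star Q'"
  unfolding star_def by blast

lemma star_subset_invertibles:
  assumes "Q \<subseteq> minimals"
  shows "star Q \<subseteq> invertibles"
proof -
  have "concat L \<in> invertibles" if "set L \<subseteq> Q" for L
    using that by (induction L) (use assms minimals_invertibles invertibles_append in auto)
  then show ?thesis unfolding star_def by blast
qed

lemma star_minimals: "star minimals = invertibles"
proof
  show "invertibles \<subseteq> star minimals"
  proof
    fix u assume "u \<in> invertibles"
    then show "u \<in> star minimals"
    proof (induction "length u" arbitrary: u rule: less_induct)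
      case less
      show ?case
      proof (cases "u = [] \<or> u \<in> minimals")
        case True
        then show ?thesis using star_singleton by auto
      next
        case False
        then obtain x y where xy: "u = x @ y" "x \<in> invertibles" "x \<noteq> []" "y \<noteq> []"
          using less.prems unfolding minimals_def by blast
        then show ?thesis
          using less invertibles_cancel_left[of x y] by (auto intro!: star_append)
      qed
    qed
  qed
qed (simp add: star_subset_invertibles)

text \<open>No minimal word is a proper prefix of another, so the first factors agree. The
  invertible words thus form a free monoid over \<open>minimals\<close>.\<close>

lemma minimals_factorization_unique:
  assumes "set L \<subseteq> minimals" "set M \<subseteq> minimals" "concat L = concat M"
  shows "L = M"
  using assms
proof (induction L arbitrary: M)
  case Nil
  then show ?case by (cases M) (auto simp: minimals_def)
next
  case (Cons p L)
  then obtain q M' where M: "M = q # M'" "q \<in> minimals" "set M' \<subseteq> minimals" "p \<in> minimals"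
    by (cases M) (auto simp: minimals_def)
  have "p \<noteq> []" "q \<noteq> []" using M by (auto simp: minimals_def)
  have "p = q"
    using Cons.prems(3) M minimals_prefix[of p] minimals_prefix[of q]
      minimals_invertibles \<open>p \<noteq> []\<close> \<open>q \<noteq> []\<close>
    by (auto simp: append_eq_append_conv2)
  with Cons M show ?case by auto
qed

text \<open>Meaningful for invertible words only; for others the description is unspecified.\<close>

definition factor :: "word \<Rightarrow> word list" where
  "factor X = (THE L. set L \<subseteq> minimals \<and> concat L = X)"

lemma factor_concat: "set L \<subseteq> minimals \<Longrightarrow> factor (concat L) = L"
  unfolding factor_def by (rule the_equality) (auto intro: minimals_factorization_unique)

lemma factor_star:
  assumes "X \<in> star Q" "Q \<subseteq> minimals"
  shows "set (factor X) \<subseteq> Q" "concat (factor X) = X"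
proof -
  obtain L where "X = concat L" "set L \<subseteq> Q" using assms unfolding star_def by blast
  then show "set (factor X) \<subseteq> Q" "concat (factor X) = X"
    using factor_concat[of L] assms(2) by auto
qed

lemma factor_invertibles:
  assumes "X \<in> invertibles"
  shows "set (factor X) \<subseteq> minimals" "concat (factor X) = X"
  using factor_star[of X minimals] assms star_minimals by auto

lemma factor_append:
  assumes "X \<in> invertibles" "Y \<in> invertibles"
  shows "factor (X @ Y) = factor X @ factor Y"
  using factor_concat[of "factor X @ factor Y"] factor_invertibles[OF assms(1)]
    factor_invertibles[OF assms(2)] by simp

lemma factor_minimals: "p \<in> minimals \<Longrightarrow> factor p = [p]"
  using factor_concat[of "[p]"] by simp

text \<open>Factoring is multiplicative, so the cut after an invertible prefix falls between two
  factors.\<close>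

lemma star_cancel:
  assumes "a @ b \<in> star Q" "Q \<subseteq> minimals" "a \<in> invertibles"
  shows "a \<in> star Q" "b \<in> star Q"
proof -
  have "b \<in> invertibles" using assms star_subset_invertibles invertibles_cancel_left by blast
  then have "set (factor a) \<subseteq> Q" "set (factor b) \<subseteq> Q"
    using factor_star(1)[OF assms(1,2)] factor_append assms(3) by auto
  then show "a \<in> star Q" "b \<in> star Q"
    using factor_invertibles(2) assms(3) \<open>b \<in> invertibles\<close> unfolding star_def
    by (metis (mono_tags, lifting) mem_Collect_eq)+
qed

text \<open>Suppose that \<open>a\<close> is not invertible, so that \<open>u\<close> begins inside
  a factor. If \<open>u\<close> reached the end of that factor, the shared part would be an overlap
  of invertible words, hence invertible, and by cancellation \<open>a\<close> would be invertible
  too.\<close>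

lemma star_factor_cases:
  assumes X: "a @ u @ b \<in> star Q" and Q: "Q \<subseteq> minimals" and u: "u \<in> invertibles"
  obtains (outer) "a \<in> star Q" "u \<in> star Q" "b \<in> star Q"
  | (inner) a1 a2 b1 b2 where "a = a1 @ a2" "b = b1 @ b2" "a1 \<in> star Q" "b2 \<in> star Q"
      "a2 @ u @ b1 \<in> Q" "a2 \<noteq> []" "b1 \<noteq> []"
proof (cases "a \<in> invertibles")
  case True
  then show ?thesis using star_cancel[OF X Q] star_cancel[of u b Q] Q u outer by blast
next
  case False
  obtain L where L: "set L \<subseteq> Q" "concat L = a @ u @ b" using X unfolding star_def by auto
  then obtain L1 x y L2 where 1: "L = L1 @ (x @ y) # L2" "a = concat L1 @ x" "u @ b = y @ concat L2"
    using False by (auto simp: concat_eq_append_conv split: if_splits)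
  have st: "concat L1 \<in> star Q" "concat L2 \<in> star Q" "x @ y \<in> Q"
    using L 1 unfolding star_def by auto
  then have x: "x \<notin> invertibles"
    using False 1 star_subset_invertibles[OF Q] invertibles_append by blast
  have y: "y \<notin> invertibles" using x st(3) Q minimals_invertibles invertibles_cancel_right by blast
  from 1(3) consider t where "u = y @ t" | t where "y = u @ t" "b = t @ concat L2"
    by (auto simp: append_eq_append_conv2)
  then show ?thesis
  proof cases
    case 1
    then show ?thesis
      using invertibles_overlap(2)[of x y t] u y st(3) Q minimals_invertibles by auto
  next
    case 2
    with x y u have "x \<noteq> []" "t \<noteq> []" by auto
    then show ?thesis using inner[of "concat L1" x t "concat L2"] st 1 2 by simp
  qed
qed

text \<open>The assumption \<open>closed\<close> makes this serve two sets:
  \<open>piecelike\<close>, where it is closure under equality, and \<open>short_pieces\<close>,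
  where the replacing word must also not be longer.\<close>

lemma star_replace:
  assumes X: "a @ u @ b \<in> star Q" and Q: "Q \<subseteq> minimals" and u: "u \<in> star Q" "u' \<in> star Q" "u \<approx> u'"
    and closed: "\<And>x y. x @ u @ y \<in> Q \<Longrightarrow> x @ u' @ y \<in> minimals \<Longrightarrow> x @ u' @ y \<in> Q"
  shows "a @ u' @ b \<in> star Q"
proof -
  have "u \<in> invertibles" using u star_subset_invertibles[OF Q] by blast
  with X Q show ?thesis
  proof (cases rule: star_factor_cases)
    case outer
    then show ?thesis using u by (intro star_append)
  next
    case (inner a1 a2 b1 b2)
    then have "a2 @ u' @ b1 \<in> Q"
      using minimals_replace Q \<open>u \<in> invertibles\<close> u by (intro closed) blast+
    then have "a1 @ (a2 @ u' @ b1) @ b2 \<in> star Q"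
      by (intro star_append[OF inner(3) star_append[OF star_singleton inner(4)]])
    then show ?thesis using inner by simp
  qed
qed

lemma R_eqv_Nil: "A \<in> set R \<Longrightarrow> A \<approx> []"
  by (simp add: eq_in_relator)

lemma R_invertibles: "A \<in> set R \<Longrightarrow> A \<in> invertibles"
  using invertibles_eqv[OF invertibles_Nil] R_eqv_Nil eq_in_sym by blast

section \<open>Pieces of the relators and the group on their classes\<close>

definition pieces :: "word set" where "pieces = (\<Union>A \<in> set R. set (factor A))"

definition piecelike :: "word set" where "piecelike = {p \<in> minimals. \<exists>r \<in> pieces. p \<approx> r}"

lemma piecelike_minimals: "piecelike \<subseteq> minimals"
  unfolding piecelike_def by blast

lemma piecelike_eqv: "p \<in> piecelike \<Longrightarrow> p \<approx> q \<Longrightarrow> q \<in> minimals \<Longrightarrow> q \<in> piecelike"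
  unfolding piecelike_def using eq_in_sym eq_in_trans by blast

lemma pieces_minimals: "pieces \<subseteq> minimals"
  unfolding pieces_def using factor_invertibles(1)[OF R_invertibles] by blast

lemma pieces_piecelike: "pieces \<subseteq> piecelike"
  unfolding piecelike_def using pieces_minimals eq_in_refl by blast

lemma R_star_piecelike: "A \<in> set R \<Longrightarrow> A \<in> star piecelike"
  unfolding star_def using factor_invertibles(2)[OF R_invertibles, of A] pieces_piecelike
  unfolding pieces_def
  by (auto intro!: exI[of _ "factor A"])

definition eqv_class :: "word \<Rightarrow> word set" where "eqv_class p = {q. p \<approx> q}"

lemma eqv_class_eq_iff: "eqv_class p = eqv_class q \<longleftrightarrow> p \<approx> q"
  unfolding eqv_class_def using eq_in_sym eq_in_trans
  by (metis (no_types, lifting) Collect_cong eq_in_refl mem_Collect_eq)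

definition num_gens :: nat where "num_gens = card (eqv_class ` piecelike)"

text \<open>An arbitrary numbering of the finitely many classes, since an alphabet has to be an
  initial segment of the natural numbers.\<close>

definition gen :: "word \<Rightarrow> nat" where
  "gen = (SOME h. bij_betw h (eqv_class ` piecelike) {..<num_gens}) \<circ> eqv_class"

definition gen_word :: "word \<Rightarrow> word" where "gen_word X = map gen (factor X)"

text \<open>Mapping the list of relators keeps their number exactly, even if some images
  coincide.\<close>

definition unit_group :: presentation where "unit_group = (num_gens, map gen_word R)"

text \<open>Every class contains one of the finitely many pieces.\<close>

lemma gen_bij: "bij_betw (SOME h. bij_betw h (eqv_class ` piecelike) {..<num_gens}) (eqv_class ` piecelike) {..<num_gens}"
proof -
  have "eqv_class ` piecelike \<subseteq> eqv_class ` pieces"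
    unfolding piecelike_def by (auto simp: eqv_class_eq_iff image_iff)
  moreover have "finite pieces"
    unfolding pieces_def by simp
  ultimately have "finite (eqv_class ` piecelike)"
    using finite_subset by blast
  then have "\<exists>h. bij_betw h (eqv_class ` piecelike) {..<num_gens}"
    using ex_bij_betw_finite_nat[of "eqv_class ` piecelike"]
    by (simp add: num_gens_def atLeast0LessThan)
  then show ?thesis by (rule someI_ex)
qed

lemma gen_eq_iff: "p \<in> piecelike \<Longrightarrow> q \<in> piecelike \<Longrightarrow> gen p = gen q \<longleftrightarrow> p \<approx> q"
  using inj_on_eq_iff[OF bij_betw_imp_inj_on[OF gen_bij] imageI imageI, of p q]
  by (simp add: gen_def eqv_class_eq_iff)

lemma gen_image: "gen ` piecelike = {..<num_gens}"
  using bij_betw_imp_surj_on[OF gen_bij] unfolding gen_def by (simp add: image_comp)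

lemma gen_word_words: "X \<in> star piecelike \<Longrightarrow> gen_word X \<in> words unit_group"
  using factor_star(1)[OF _ piecelike_minimals] gen_image
  unfolding gen_word_def words_def unit_group_def by fastforce

lemma gen_word_append: "X \<in> star piecelike \<Longrightarrow> Y \<in> star piecelike \<Longrightarrow> gen_word (X @ Y) = gen_word X @ gen_word Y"
  using star_subset_invertibles[OF piecelike_minimals] unfolding gen_word_def
  by (simp add: factor_append subset_iff)

lemma gen_word_piecelike: "p \<in> piecelike \<Longrightarrow> gen_word p = [gen p]"
  unfolding gen_word_def using factor_minimals piecelike_minimals by auto

lemma gen_word_Nil [simp]: "gen_word [] = []"
  unfolding gen_word_def using factor_concat[of "[]"] by simp

text \<open>Applied with the empty word and a relator in either order, this treats insertions and
  deletions alike. If the replacement happens inside a factor, both images are the same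
  word.\<close>

lemma gen_word_replace:
  assumes X: "a @ u @ b \<in> star piecelike" and u: "u \<in> star piecelike" "u' \<in> star piecelike" "u \<approx> u'"
    and unit_group: "eq_in unit_group (gen_word u) (gen_word u')"
  shows "a @ u' @ b \<in> star piecelike"
    "eq_in unit_group (gen_word (a @ u @ b)) (gen_word (a @ u' @ b))"
proof -
  have "x @ u' @ y \<in> piecelike" if "x @ u @ y \<in> piecelike" "x @ u' @ y \<in> minimals" for x y
    using piecelike_eqv[OF that(1) eq_in_context[OF u(3)] that(2)] .
  then show "a @ u' @ b \<in> star piecelike" by (rule star_replace[OF X piecelike_minimals u])
  have "u \<in> invertibles" using u star_subset_invertibles[OF piecelike_minimals] by blast
  with X piecelike_minimals show "eq_in unit_group (gen_word (a @ u @ b)) (gen_word (a @ u' @ b))"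
  proof (cases rule: star_factor_cases)
    case outer
    then show ?thesis
      using eq_in_context[OF unit_group] u by (simp add: gen_word_append star_append)
  next
    case (inner a1 a2 b1 b2)
    let ?p = "a2 @ u @ b1" and ?p' = "a2 @ u' @ b1"
    have "?p' \<in> minimals"
      using inner minimals_replace[OF _ _ _ \<open>u \<in> invertibles\<close> u(3)] piecelike_minimals by blast
    moreover have "?p \<approx> ?p'" using u(3) by (rule eq_in_context)
    ultimately have piecelike: "?p' \<in> piecelike" "gen ?p = gen ?p'"
      using inner(5) piecelike_eqv gen_eq_iff by blast+
    have "gen_word (a @ u @ b) = gen_word (a1 @ ?p @ b2)"
      "gen_word (a @ u' @ b) = gen_word (a1 @ ?p' @ b2)"
      using inner by simp_all
    then have "gen_word (a @ u @ b) = gen_word (a @ u' @ b)"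
      using inner(3-5) piecelike
      by (simp only: gen_word_append star_append star_singleton gen_word_piecelike)
    then show ?thesis by simp
  qed
qed

lemma gen_word_relator:
  assumes "A \<in> set R"
  shows "eq_in unit_group (gen_word A) []"
  using assms by (intro eq_in_relator) (simp add: unit_group_def)

lemma eqv_imp_gen_word_eq:
  assumes "X \<approx> Y" "X \<in> star piecelike"
  shows "Y \<in> star piecelike \<and> eq_in unit_group (gen_word X) (gen_word Y)"
  using assms(1) unfolding eq_in_def[of "(0, R)"]
proof (induction rule: equivclp_induct)
  case base
  then show ?case using assms(2) by simp
next
  case (step Y Z)
  from step.hyps(2) obtain U A V where A: "A \<in> set R"
    and "Y = U @ V \<and> Z = U @ A @ V \<or> Z = U @ V \<and> Y = U @ A @ V"
    unfolding insertion_def by auto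
  then have "Z \<in> star piecelike \<and> eq_in unit_group (gen_word Y) (gen_word Z)"
    using step.IH gen_word_replace[of U "[]" V A] gen_word_replace[of U A V "[]"]
      R_eqv_Nil[OF A] R_star_piecelike[OF A] gen_word_relator[OF A] eq_in_sym[of unit_group] eq_in_sym[OF R_eqv_Nil[OF A]]
    by (elim disjE conjE) simp_all
  then show ?case using step.IH eq_in_trans by blast
qed

text \<open>Substituting a representative for each generator turns the image of a word back into a
  word equal to the original one. In particular the relators of the group become words equal to
  1.\<close>

lemma gen_word_eq_imp_eqv:
  assumes "eq_in unit_group (gen_word X) (gen_word Y)" "X \<in> star piecelike" "Y \<in> star piecelike"
  shows "X \<approx> Y"
proof -
  define \<sigma> where "\<sigma> = inv_into piecelike gen"
  have *: "concat (map \<sigma> (map gen L)) \<approx> concat L" if "set L \<subseteq> piecelike" for L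
    using that
  proof (induction L)
    case (Cons p L)
    then have "\<sigma> (gen p) \<in> piecelike" "gen (\<sigma> (gen p)) = gen p"
      unfolding \<sigma>_def by (auto intro!: inv_into_into f_inv_into_f)
    then have "\<sigma> (gen p) \<approx> p" using Cons.prems gen_eq_iff[of "\<sigma> (gen p)" p] by simp
    with Cons show ?case by (simp add: eq_in_append)
  qed simp
  have \<sigma>: "concat (map \<sigma> (gen_word X)) \<approx> X" if "X \<in> star piecelike" for X
    using *[of "factor X"] factor_star[OF that piecelike_minimals] unfolding gen_word_def by simp
  have "X \<approx> concat (map \<sigma> (gen_word X))"
    by (rule eq_in_sym) (rule \<sigma>[OF assms(2)])
  also have "concat (map \<sigma> (gen_word X)) \<approx> concat (map \<sigma> (gen_word Y))"
  proof (rule eq_in_hom)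
    show "eq_in (num_gens, map gen_word R) (gen_word X) (gen_word Y)" using assms(1)
      unfolding unit_group_def .
    fix A' assume "A' \<in> set (map gen_word R)"
    then obtain A where A: "A \<in> set R" "A' = gen_word A" by auto
    then show "concat (map \<sigma> A') \<approx> []"
      using eq_in_trans[OF \<sigma>[OF R_star_piecelike[OF A(1)]] R_eqv_Nil[OF A(1)]] by simp
  qed
  also have "concat (map \<sigma> (gen_word Y)) \<approx> Y" by (rule \<sigma>[OF assms(3)])
  finally show ?thesis .
qed

lemma eqv_iff_gen_word_eq:
  "X \<in> star piecelike \<Longrightarrow> Y \<in> star piecelike \<Longrightarrow> X \<approx> Y \<longleftrightarrow> eq_in unit_group (gen_word X) (gen_word Y)"
  using eqv_imp_gen_word_eq gen_word_eq_imp_eqv by blast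

text \<open>A piece \<open>r\<close> occurs in a relator \<open>x r y\<close>, and cyclic
  conjugation makes \<open>y x\<close> inverse to it on both sides. This inverse is a product of
  pieces and so has an image in the group.\<close>

lemma generator_invertible:
  assumes "g < num_gens"
  shows "two_sided_invertible unit_group [g]"
proof -
  have "g \<in> gen ` piecelike" using assms gen_image by simp
  then obtain p where "p \<in> piecelike" "gen p = g" by auto
  then obtain r where "r \<in> pieces" "p \<approx> r"
    unfolding piecelike_def by blast
  with \<open>p \<in> piecelike\<close> \<open>gen p = g\<close> have r: "r \<in> pieces" "gen r = g"
    using gen_eq_iff[of p r] pieces_piecelike by auto
  then obtain A L1 L2 where A: "A \<in> set R" "factor A = L1 @ r # L2"
    unfolding pieces_def using split_list by fast
  define x y where "x = concat L1" and "y = concat L2"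
  have "set (factor A) \<subseteq> piecelike"
    using factor_star(1)[OF R_star_piecelike[OF A(1)] piecelike_minimals] .
  then have sub: "set L1 \<subseteq> piecelike" "r \<in> piecelike" "set L2 \<subseteq> piecelike"
    using A(2) by auto
  have star: "x \<in> star piecelike" "y \<in> star piecelike" "r \<in> star piecelike"
    using sub star_singleton unfolding x_def y_def by (auto simp: star_def)
  then have invertibles: "x \<in> invertibles" "y \<in> invertibles" "r \<in> invertibles"
    by (auto intro: subsetD[OF star_subset_invertibles[OF piecelike_minimals]])
  have "A = x @ r @ y" using factor_invertibles(2)[OF R_invertibles[OF A(1)]]
    unfolding A(2) x_def y_def by simp
  then have xry: "x @ r @ y \<approx> []" using R_eqv_Nil[OF A(1)] by simp
  have "r @ y @ x \<approx> []"
    using conjugate_eq_Nil[OF xry] invertibles unfolding invertibles_def by simp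
  moreover have "y @ x @ r \<approx> []"
    using conjugate_eq_Nil[of "x @ r" y] xry invertibles_append[OF invertibles(1,3)]
    unfolding invertibles_def by simp
  ultimately have "eq_in unit_group (gen_word (r @ y @ x)) (gen_word [])"
    "eq_in unit_group (gen_word (y @ x @ r)) (gen_word [])"
    using star by (simp_all only: star_append star_Nil eqv_iff_gen_word_eq[symmetric])
  then have "eq_in unit_group ([g] @ gen_word (y @ x)) []"
    "eq_in unit_group (gen_word (y @ x) @ [g]) []"
    using star sub r by (simp_all add: gen_word_append gen_word_piecelike star_append)
  then show ?thesis
    unfolding two_sided_invertible_def using gen_word_words[OF star_append[OF star(2,1)]] by blast
qed

lemma unit_group_group:
  assumes "length R = k" "\<And>A. A \<in> set R \<Longrightarrow> length A \<le> l"
  shows "kl_group k l unit_group"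
proof -
  have "length (gen_word A) \<le> l" if "A \<in> set R" for A
  proof -
    have "length L \<le> length (concat L)" if "set L \<subseteq> minimals" for L
      using that
    proof (induction L)
      case (Cons p L)
      then have "p \<noteq> []" by (simp add: minimals_def)
      with Cons show ?case by (cases p) auto
    qed simp
    from this[of "factor A"] show ?thesis
      using factor_invertibles[OF R_invertibles[OF that]] assms(2)[OF that]
      unfolding gen_word_def by simp
  qed
  then have "kl_semigroup k l unit_group"
    using assms(1) gen_word_words[OF R_star_piecelike] unfolding kl_semigroup_def
    by (auto simp: unit_group_def)
  moreover have "two_sided_invertible unit_group X" if "X \<in> words unit_group" for X
    using that
  proof (induction X)
    case Nil
    then show ?case
      unfolding two_sided_invertible_def by (auto intro!: bexI[of _ "[]"])
  next
    case (Cons g X)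
    then show ?case
      using two_sided_invertible_append[of unit_group "[g]" X] generator_invertible
      unfolding words_def by (simp add: unit_group_def)
  qed
  ultimately show ?thesis unfolding kl_group_def by blast
qed

end

section \<open>The length-lexicographic rank of a word\<close>

text \<open>Reading a word in base \<open>B\<close> behind a leading digit \<open>1\<close> makes longer words larger.\<close>

definition rank :: "nat \<Rightarrow> word \<Rightarrow> nat" where
  "rank B w = foldl (\<lambda>acc d. acc * B + d) 1 w"

lemma rank_Nil: "rank B [] = 1"
  by (simp add: rank_def)

lemma rank_snoc: "rank B (w @ [d]) = rank B w * B + d"
  by (simp add: rank_def)

lemma rank_pos: "0 < B \<Longrightarrow> 0 < rank B w"
  by (induction w rule: rev_induct) (auto simp: rank_Nil rank_snoc)

lemma digit_less:
  assumes "x < (y :: nat)" "d < B"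
  shows "x * B + d < y * B + e"
proof -
  have "x * B + d < Suc x * B" using assms(2) by simp
  also have "Suc x * B \<le> y * B" using assms(1) by (intro mult_right_mono) auto
  finally show ?thesis by simp
qed

lemma rank_snoc_greater:
  assumes "2 \<le> B"
  shows "1 < rank B (w @ [d])"
proof -
  have "1 * 2 \<le> rank B w * B"
    using rank_pos[of B w] assms by (intro mult_le_mono) auto
  then show ?thesis by (simp add: rank_snoc)
qed

lemma rank_inj:
  assumes "2 \<le> B" "set u \<subseteq> {..<B}" "set v \<subseteq> {..<B}" "rank B u = rank B v"
  shows "u = v"
  using assms(2-)
proof (induction u arbitrary: v rule: rev_induct)
  case Nil
  then show ?case
    using rank_snoc_greater[OF assms(1)] by (cases v rule: rev_exhaust) (auto simp: rank_Nil)
next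
  case (snoc d u)
  then obtain e v' where v: "v = v' @ [e]"
    using rank_snoc_greater[OF assms(1), of u d]
    by (cases v rule: rev_exhaust) (auto simp: rank_Nil)
  have "rank B u = rank B v' \<and> d = e"
    using snoc.prems v digit_less[of "rank B u" "rank B v'" d B e]
      digit_less[of "rank B v'" "rank B u" e B d]
    by (cases "rank B u" "rank B v'" rule: linorder_cases) (auto simp: rank_snoc)
  with snoc v show ?case by auto
qed

lemma rank_le_imp_length_le:
  assumes "2 \<le> B" "set v \<subseteq> {..<B}" "rank B u \<le> rank B v"
  shows "length u \<le> length v"
  using assms(2-)
proof (induction v arbitrary: u rule: rev_induct)
  case Nil
  then show ?case
    using rank_snoc_greater[OF assms(1)]
    by (cases u rule: rev_exhaust) (auto simp: rank_Nil dest: leD)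
next
  case (snoc e v)
  show ?case
  proof (cases u rule: rev_exhaust)
    case (snoc u' d)
    with snoc.prems have "rank B u' \<le> rank B v"
      using digit_less[of "rank B v" "rank B u'" e B d]
      by (auto simp: rank_snoc intro: leI dest: leD)
    then have "length u' \<le> length v"
      using snoc.IH snoc.prems by simp
    then show ?thesis
      using snoc by simp
  qed simp
qed

text \<open>The leading digit 1 of \<open>w\<close> contributes \<open>B ^ length w\<close>. Behind
  \<open>a\<close> it is replaced by \<open>rank B a\<close>, whence the factor
  \<open>rank B a - 1\<close>.\<close>

lemma rank_append: "0 < B \<Longrightarrow> rank B (a @ w) = rank B w + (rank B a - 1) * B ^ length w"
proof (induction w rule: rev_induct)
  case Nil
  then show ?case using rank_pos[of B a] by (simp add: rank_Nil)
next
  case (snoc d w)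
  have "rank B (a @ w @ [d]) = rank B (a @ w) * B + d"
    using rank_snoc[of B "a @ w"] by simp
  also have "\<dots> = (rank B w + (rank B a - 1) * B ^ length w) * B + d"
    by (simp only: snoc)
  also have "\<dots> = rank B (w @ [d]) + (rank B a - 1) * B ^ length (w @ [d])"
    by (simp add: rank_snoc add_mult_distrib)
  finally show ?case by simp
qed

text \<open>Since \<open>u\<close> is not longer than \<open>v\<close>, it shifts the prefix
  \<open>a\<close> by at most as many places; the suffix appends the same digits to both.\<close>

lemma rank_context:
  assumes "2 \<le> B" "set v \<subseteq> {..<B}" "rank B u < rank B v"
  shows "rank B (a @ u @ b) < rank B (a @ v @ b)"
proof (induction b rule: rev_induct)
  case Nil
  have "length u \<le> length v"
    using assms by (intro rank_le_imp_length_le) auto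
  then have "(rank B a - 1) * B ^ length u \<le> (rank B a - 1) * B ^ length v"
    using assms(1) by (intro mult_left_mono power_increasing) auto
  from add_less_le_mono[OF assms(3) this] show ?case
    using assms(1) by (simp add: rank_append)
next
  case (snoc d b)
  then have "rank B (a @ u @ b) * B < rank B (a @ v @ b) * B"
    using assms(1) by simp
  then show ?case
    using rank_snoc[of B "a @ u @ b" d] rank_snoc[of B "a @ v @ b" d] by simp
qed

section \<open>The rewriting system\<close>

lemma normal_form_exists:
  fixes f :: "'a \<Rightarrow> nat"
  assumes "\<And>x y. r x y \<Longrightarrow> f y < f x"
  shows "\<exists>y. r\<^sup>*\<^sup>* x y \<and> (\<forall>z. \<not> r y z)"
proof (induction "f x" arbitrary: x rule: less_induct)
  case less
  then show ?case
    using assms by (metis converse_rtranclp_into_rtranclp rtranclp.rtrancl_refl)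
qed

text \<open>Newman's lemma, with a numerical measure for termination: both results agree with a
  normal form of the point where the two first steps meet again.\<close>

lemma normal_form_unique:
  fixes f :: "'a \<Rightarrow> nat"
  assumes decreasing: "\<And>x y. r x y \<Longrightarrow> f y < f x"
    and locally_confluent: "\<And>x y z. r x y \<Longrightarrow> r x z \<Longrightarrow> \<exists>w. r\<^sup>*\<^sup>* y w \<and> r\<^sup>*\<^sup>* z w"
    and "r\<^sup>*\<^sup>* x y" "r\<^sup>*\<^sup>* x z" "\<And>w. \<not> r y w" "\<And>w. \<not> r z w"
  shows "y = z"
  using assms(3-)
proof (induction "f x" arbitrary: x y z rule: less_induct)
  case less
  show ?case
  proof (cases "x = y \<or> x = z")
    case True
    then show ?thesis using less.prems by (metis converse_rtranclpE)
  next
    case False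
    then obtain y' z' where *: "r x y'" "r\<^sup>*\<^sup>* y' y" "r x z'" "r\<^sup>*\<^sup>* z' z"
      using less.prems(1,2) by (metis converse_rtranclpE)
    obtain w where w: "r\<^sup>*\<^sup>* y' w" "r\<^sup>*\<^sup>* z' w"
      using locally_confluent[OF *(1,3)] by blast
    obtain n where n: "r\<^sup>*\<^sup>* w n" "\<And>v. \<not> r n v"
      using normal_form_exists[of r f w] decreasing by blast
    have "y = n"
      using less.hyps[OF decreasing[OF *(1)] *(2) rtranclp_trans[OF w(1) n(1)] less.prems(3) n(2)] .
    moreover have "z = n"
      using less.hyps[OF decreasing[OF *(3)] *(4) rtranclp_trans[OF w(2) n(1)] less.prems(4) n(2)] .
    ultimately show ?thesis by simp
  qed
qed

section \<open>Reduction of products of short pieces and its confluence\<close>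

locale bounded_special_monoid = special_monoid +
  fixes l B :: nat
  assumes relator_length: "A \<in> set R \<Longrightarrow> length A \<le> l"
    and relator_letters: "A \<in> set R \<Longrightarrow> set A \<subseteq> {..<B}"
    and B: "2 \<le> B"
begin

text \<open>A letter from \<open>B\<close> on occurs in no relator, so insertions and deletions
  never touch it.\<close>

lemma letter_count:
  assumes "u \<approx> v" "B \<le> x"
  shows "count_list u x = count_list v x"
proof -
  \<comment> \<open>Without relators, equality is literal equality.\<close>
  have "eq_in (0, []) (filter ((=) x) u) (filter ((=) x) v)"
    using assms(1)
  proof (rule eq_in_preserved)
    fix U A V assume "A \<in> set (snd (0 :: nat, R))"
    then have "filter ((=) x) A = []"
      using relator_letters[of A] assms(2) by (auto simp: filter_empty_conv)
    then show "eq_in (0, []) (filter ((=) x) (U @ A @ V)) (filter ((=) x) (U @ V))"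
      by simp
  qed
  then have "filter ((=) x) u = filter ((=) x) v"
    unfolding eq_in_def by (induction rule: equivclp_induct) (auto simp: insertion_def)
  then show ?thesis by (metis count_list_eq_length_filter)
qed

text \<open>No inverse can remove a foreign letter, as the number of its occurrences is invariant.
  This makes the set of short pieces finite and lets ranks be compared.\<close>

lemma invertibles_letters:
  assumes "u \<in> invertibles"
  shows "set u \<subseteq> {..<B}"
proof
  fix x assume "x \<in> set u"
  from assms obtain y where "y @ u \<approx> []" unfolding invertibles_def linv_def by blast
  then have "B \<le> x \<Longrightarrow> count_list (y @ u) x = 0"
    using letter_count by fastforce
  then show "x \<in> {..<B}"
    using \<open>x \<in> set u\<close> by (simp add: count_list_0_iff) (meson not_le)
qed

definition short_pieces :: "word set" where "short_pieces = {p \<in> piecelike. length p \<le> l}"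

lemma short_pieces_piecelike: "short_pieces \<subseteq> piecelike"
  unfolding short_pieces_def by blast

lemma short_pieces_minimals: "short_pieces \<subseteq> minimals"
  using short_pieces_piecelike piecelike_minimals by blast

lemma finite_short_pieces: "finite short_pieces"
proof (rule finite_subset)
  show "short_pieces \<subseteq> {w. set w \<subseteq> {..<B} \<and> length w \<le> l}"
    using invertibles_letters minimals_invertibles short_pieces_minimals
    unfolding short_pieces_def by blast
  show "finite {w. set w \<subseteq> {..<B} \<and> length w \<le> l}"
    by (rule finite_lists_length_le) simp
qed

lemma star_short_pieces_invertibles: "star short_pieces \<subseteq> invertibles"
  by (rule star_subset_invertibles[OF short_pieces_minimals])

lemma star_short_pieces_piecelike: "star short_pieces \<subseteq> star piecelike"
  by (rule star_mono[OF short_pieces_piecelike])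

lemma R_star_short_pieces:
  assumes "A \<in> set R"
  shows "A \<in> star short_pieces"
proof -
  have factor: "concat (factor A) = A" "set (factor A) \<subseteq> piecelike"
    using factor_star[OF R_star_piecelike[OF assms] piecelike_minimals] by simp_all
  have len: "length p \<le> length (concat L)" if "p \<in> set L" for p and L :: "word list"
    using that by (induction L) auto
  have "set (factor A) \<subseteq> short_pieces"
  proof
    fix p assume p: "p \<in> set (factor A)"
    then show "p \<in> short_pieces"
      using len[OF p] factor relator_length[OF assms] by (auto simp: short_pieces_def)
  qed
  with factor(1) show ?thesis
    unfolding star_def by (intro CollectI exI[of _ "factor A"]) simp
qed

definition red :: "word \<Rightarrow> word \<Rightarrow> bool" where
  "red X Y \<longleftrightarrow> (\<exists>a u u' b. X = a @ u @ b \<and> Y = a @ u' @ b \<and> u \<in> star short_pieces \<and> u' \<in> star short_pieces \<and>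
     u \<approx> u' \<and> rank B u' < rank B u)"

lemma red_rank: "red X Y \<Longrightarrow> rank B Y < rank B X"
  unfolding red_def
  using rank_context[OF B] invertibles_letters star_short_pieces_invertibles by blast

lemma red_eqv: "red X Y \<Longrightarrow> X \<approx> Y"
  unfolding red_def using eq_in_context by blast

text \<open>Ranks are injective on such words, so of two different ones that are equal in the
  monoid, one rewrites to the other in a single step. All overlaps of reductions are resolved in
  this way.\<close>

lemma red_joinable:
  assumes "v \<in> star short_pieces" "w \<in> star short_pieces" "v \<approx> w"
  shows "\<exists>Z. red\<^sup>*\<^sup>* (a @ v @ b) Z \<and> red\<^sup>*\<^sup>* (a @ w @ b) Z"
proof (cases "rank B v" "rank B w" rule: linorder_cases)
  case less
  then have "red (a @ w @ b) (a @ v @ b)" unfolding red_def using assms eq_in_sym by blast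
  then show ?thesis by blast
next
  case equal
  then have "v = w"
    using rank_inj[OF B] invertibles_letters star_short_pieces_invertibles assms by blast
  then show ?thesis by blast
next
  case greater
  then have "red (a @ v @ b) (a @ w @ b)" unfolding red_def using assms by blast
  then show ?thesis by blast
qed

lemma short_pieces_replace:
  assumes "a @ u @ b \<in> star short_pieces" "u \<in> star short_pieces" "u' \<in> star short_pieces" "u \<approx> u'"
    "rank B u' \<le> rank B u"
  shows "a @ u' @ b \<in> star short_pieces"
proof (rule star_replace[OF assms(1) short_pieces_minimals assms(2-4)])
  fix x y assume "x @ u @ y \<in> short_pieces" "x @ u' @ y \<in> minimals"
  moreover have "length u' \<le> length u"
    using rank_le_imp_length_le[OF B] assms invertibles_letters star_short_pieces_invertibles by
      blast
  ultimately show "x @ u' @ y \<in> short_pieces"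
    using piecelike_eqv[OF _ eq_in_context[OF assms(4)]] unfolding short_pieces_def by force
qed

lemma red_locally_confluent_left:
  assumes eq: "a @ u @ b = a' @ v @ b'" and le: "length a \<le> length a'"
    and u: "u \<in> star short_pieces" "u' \<in> star short_pieces" "u \<approx> u'" "rank B u' < rank B u"
    and v: "v \<in> star short_pieces" "v' \<in> star short_pieces" "v \<approx> v'" "rank B v' < rank B v"
  shows "\<exists>Z. red\<^sup>*\<^sup>* (a @ u' @ b) Z \<and> red\<^sup>*\<^sup>* (a' @ v' @ b') Z"
proof -
  obtain us where "a = a' @ us \<and> us @ u @ b = v @ b' \<or> a @ us = a' \<and> u @ b = us @ v @ b'"
    using eq unfolding append_eq_append_conv2 by blast
  with le have "a' = a @ us \<and> u @ b = us @ v @ b'"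
    by auto
  then obtain e where e: "a' = a @ e" "u @ b = e @ v @ b'"
    by blast
  from e(2) consider (disjoint) f where "e = u @ f" "b = f @ v @ b'"
    | (overlap) g where "u = e @ g" "g @ b = v @ b'"
    by (auto simp: append_eq_append_conv2)
  then show ?thesis
  proof cases
    case disjoint
    have "red (a @ u' @ f @ v @ b') (a @ u' @ f @ v' @ b')"
      unfolding red_def using v
      by (intro exI[of _ "a @ u' @ f"] exI[of _ v] exI[of _ v'] exI[of _ b']) simp
    moreover have "red (a @ u @ f @ v' @ b') (a @ u' @ f @ v' @ b')"
      unfolding red_def using u
      by (intro exI[of _ a] exI[of _ u] exI[of _ u'] exI[of _ "f @ v' @ b'"]) simp
    ultimately show ?thesis using disjoint e by auto
  next
    case overlap
    from overlap(2) consider (inside) h where "g = v @ h" "b' = h @ b"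
      | (proper) h where "v = g @ h" "b = h @ b'"
      by (auto simp: append_eq_append_conv2)
    then show ?thesis
    proof cases
      \<comment> \<open>The second step acts inside \<open>u\<close>; its result there is again a
        product of short pieces, and it equals \<open>u'\<close> in the monoid.\<close>
      case inside
      then have "e @ v' @ h \<in> star short_pieces"
        using short_pieces_replace[of e v h v'] u v overlap by simp
      moreover have "u' \<approx> e @ v' @ h"
        using eq_in_trans[OF eq_in_sym[OF u(3)]] eq_in_context[OF v(3)] overlap inside by simp
      ultimately show ?thesis
        using red_joinable[OF u(2), of "e @ v' @ h" a b] inside overlap e by simp
    next
      \<comment> \<open>The overlap \<open>g\<close> and the remainders \<open>e\<close> and
        \<open>h\<close> are invertible, so the cuts fall between factors. Hence
        \<open>u' @ h\<close> and \<open>e @ v'\<close> are equal products of short pieces.\<close>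
      case proper
      have gI: "e \<in> invertibles" "g \<in> invertibles" "h \<in> invertibles"
        using invertibles_overlap[of e g h] u v proper overlap star_short_pieces_invertibles by auto
      then have "e \<in> star short_pieces" "h \<in> star short_pieces"
        using star_cancel[OF _ short_pieces_minimals, of e g]
          star_cancel[OF _ short_pieces_minimals, of g h] u v proper overlap by auto
      then have "u' @ h \<in> star short_pieces" "e @ v' \<in> star short_pieces"
        using u v star_append by auto
      moreover have "u' @ h \<approx> e @ v'"
        using eq_in_trans[OF eqv_right[OF eq_in_sym[OF u(3)], of h] , of "e @ v'"]
          eqv_left[OF v(3), of e]
          overlap proper by simp
      ultimately show ?thesis
        using red_joinable[of "u' @ h" "e @ v'" a b'] proper overlap e by simp
    qed
  qed
qed

lemma red_locally_confluent:
  assumes "red X Y" "red X Z"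
  shows "\<exists>W. red\<^sup>*\<^sup>* Y W \<and> red\<^sup>*\<^sup>* Z W"
proof -
  from assms(1) obtain a u u' b where u: "X = a @ u @ b" "Y = a @ u' @ b"
    "u \<in> star short_pieces" "u' \<in> star short_pieces" "u \<approx> u'" "rank B u' < rank B u"
    unfolding red_def by blast
  from assms(2) obtain a' v v' b' where v: "X = a' @ v @ b'" "Z = a' @ v' @ b'"
    "v \<in> star short_pieces" "v' \<in> star short_pieces" "v \<approx> v'" "rank B v' < rank B v"
    unfolding red_def by blast
  show ?thesis
  proof (cases "length a \<le> length a'")
    case True
    then show ?thesis
      using red_locally_confluent_left[of a u b a' v b' u' v'] u v by simp
  next
    case False
    then show ?thesis
      using red_locally_confluent_left[of a' v b' a u b v' u'] u v by auto
  qed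
qed

text \<open>A nonempty relator is a product of short pieces equal to 1 and so rewrites to the empty
  word; hence insertions preserve normal forms.\<close>

lemma eqv_iff_normal_forms_eq:
  assumes nf: "\<And>X. red\<^sup>*\<^sup>* X (nf X)" "\<And>X Y. \<not> red (nf X) Y"
  shows "X \<approx> Y \<longleftrightarrow> nf X = nf Y"
proof
  have red_nf: "nf X = nf Y" if "red X Y" for X Y
    using normal_form_unique[of red "rank B" X "nf X" "nf Y"] red_rank red_locally_confluent nf
      converse_rtranclp_into_rtranclp[OF that nf(1)] by blast
  have *: "nf (U @ A @ V) = nf (U @ V)" if "A \<in> set R" for U A V
  \<comment> \<open>An empty relator gives no decreasing step, but its deletion changes
    nothing.\<close>
  proof (cases "A = []")
    case False
    then have "rank B [] < rank B A"
      using rank_snoc_greater[OF B] by (cases A rule: rev_exhaust) (auto simp: rank_Nil)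
    then have "red (U @ A @ V) (U @ [] @ V)"
      unfolding red_def using R_star_short_pieces[OF that] R_eqv_Nil[OF that] star_Nil by blast
    then show ?thesis using red_nf by simp
  qed simp
  show "X \<approx> Y \<Longrightarrow> nf X = nf Y"
    unfolding eq_in_def by (induction rule: equivclp_induct) (auto simp: insertion_def *)
next
  have *: "X \<approx> nf X" for X
    using nf(1)[of X] by (induction rule: rtranclp_induct) (auto intro: eq_in_trans red_eqv)
  show "nf X = nf Y \<Longrightarrow> X \<approx> Y"
    using *[of X] *[of Y] by (metis eq_in_sym eq_in_trans)
qed

end

section \<open>Computing the normal forms\<close>

definition lists_upto :: "'a list \<Rightarrow> nat \<Rightarrow> 'a list list" where
  "lists_upto T n = rec_nat [[]] (\<lambda>_ L. [] # concat (map (\<lambda>w. map (\<lambda>d. d # w) T) L)) n"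

lemma set_lists_upto: "set (lists_upto T n) = {w. set w \<subseteq> set T \<and> length w \<le> n}"
proof (induction n)
  case (Suc n)
  have "w \<in> set (lists_upto T (Suc n)) \<longleftrightarrow> set w \<subseteq> set T \<and> length w \<le> Suc n" for w
    using Suc unfolding lists_upto_def by (cases w) auto
  then show ?case by blast
qed (auto simp: lists_upto_def)

lemma computable_lists_upto [computable_intros]:
  assumes "computable n"
  shows "computable (\<lambda>x. lists_upto T (n x))"
  unfolding lists_upto_def by (intro computable_intros assms)

lemma computable_rank [computable_intros]:
  assumes "computable w"
  shows "computable (\<lambda>x. rank B (w x))"
  unfolding rank_def by (intro computable_intros assms)

text \<open>The lists are over a table of short pieces paired with the numbers of their classes: the
  first components spell a word, the second ones its image in the group.\<close>

definition spell :: "(word \<times> nat) list \<Rightarrow> word" where "spell L = concat (map fst L)"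

lemma computable_spell [computable_intros]:
  assumes "computable L"
  shows "computable (\<lambda>x. spell (L x))"
  unfolding spell_def by (intro computable_intros assms)

text \<open>The bound \<open>length X\<close> on both lists loses nothing: short pieces are
  nonempty, and a replacing word is not longer than the replaced one. \<open>D\<close> stands for
  the decision of equality in the group.\<close>

definition reducts ::
  "(word \<times> nat) list \<Rightarrow> (word \<Rightarrow> word \<Rightarrow> bool) \<Rightarrow> nat \<Rightarrow> word \<Rightarrow> word list" where
  "reducts T D B X =
    map (\<lambda>q. take (fst q) X @ spell (snd (snd q)) @ drop (fst q + length (spell (fst (snd q)))) X)
     (filter (\<lambda>q. take (length (spell (fst (snd q)))) (drop (fst q) X) = spell (fst (snd q)) \<and>
        rank B (spell (snd (snd q))) < rank B (spell (fst (snd q))) \<and>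
        D (map snd (fst (snd q))) (map snd (snd (snd q))))
      (concat (map (\<lambda>i. concat (map (\<lambda>L. map (\<lambda>M. (i, L, M)) (lists_upto T (length X)))
         (lists_upto T (length X)))) [0..<Suc (length X)])))"

lemma set_reducts:
  "set (reducts T D B X) = {take i X @ spell M @ drop (i + length (spell L)) X |i L M.
     i \<le> length X \<and> L \<in> set (lists_upto T (length X)) \<and> M \<in> set (lists_upto T (length X)) \<and>
     take (length (spell L)) (drop i X) = spell L \<and> rank B (spell M) < rank B (spell L) \<and>
     D (map snd L) (map snd M)}"
  unfolding reducts_def by (force simp: less_Suc_eq_le simp del: upt_Suc)

lemma computable_reducts [computable_intros]:
  assumes D: "decidable (\<lambda>p. D (fst p) (snd p))" and X: "computable X"
  shows "computable (\<lambda>x. reducts T D B (X x))"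
proof -
  have D': "decidable (\<lambda>x. D (U x) (V x))"
    if "computable U" "computable V" for U V :: "'b :: encodable \<Rightarrow> word"
    using decidable_comp[OF D computable_Pair[OF that]] by simp
  show ?thesis
    unfolding reducts_def by (intro computable_intros D' X[THEN computable_comp])
qed

text \<open>Enough rounds, since each reduction lowers the rank and ranks stay positive; a word
  without reducts is kept.\<close>

definition normal_form ::
  "(word \<times> nat) list \<Rightarrow> (word \<Rightarrow> word \<Rightarrow> bool) \<Rightarrow> nat \<Rightarrow> word \<Rightarrow> word" where
  "normal_form T D B X =
    rec_nat X (\<lambda>_ Y. case reducts T D B Y of [] \<Rightarrow> Y | Z # _ \<Rightarrow> Z) (rank B X)"

lemma computable_normal_form [computable_intros]:
  assumes "decidable (\<lambda>p. D (fst p) (snd p))" and "computable X"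
  shows "computable (\<lambda>x. normal_form T D B (X x))"
  unfolding normal_form_def by (intro computable_intros assms)

context bounded_special_monoid
begin

lemma star_short_pieces_spell:
  assumes T: "set T = (\<lambda>p. (p, gen p)) ` short_pieces"
  shows "u \<in> star short_pieces \<longleftrightarrow> (\<exists>L. set L \<subseteq> set T \<and> spell L = u)"
    and "set L \<subseteq> set T \<Longrightarrow> gen_word (spell L) = map snd L"
    and "set L \<subseteq> set T \<Longrightarrow> length L \<le> length (spell L)"
proof -
  have fst: "set (map fst L) \<subseteq> short_pieces" "map gen (map fst L) = map snd L"
    "[] \<notin> set (map fst L)"
    if "set L \<subseteq> set T" for L
    using that short_pieces_minimals unfolding T minimals_def by auto
  show "gen_word (spell L) = map snd L" if "set L \<subseteq> set T"
  proof -
    have "set (map fst L) \<subseteq> minimals" using fst(1)[OF that] short_pieces_minimals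
      by (rule subset_trans)
    then show ?thesis
      unfolding gen_word_def spell_def by (simp only: factor_concat fst(2)[OF that])
  qed
  show "length L \<le> length (spell L)" if "set L \<subseteq> set T"
  proof -
    have "length M \<le> length (concat M)" if "[] \<notin> set M" for M :: "word list"
      using that
    proof (induction M)
      case (Cons w M)
      then show ?case by (cases w) auto
    qed simp
    from this[OF fst(3)[OF that]] show ?thesis unfolding spell_def by simp
  qed
  show "u \<in> star short_pieces \<longleftrightarrow> (\<exists>L. set L \<subseteq> set T \<and> spell L = u)"
  proof
    assume "u \<in> star short_pieces"
    then obtain M where M: "set M \<subseteq> short_pieces" "u = concat M" unfolding star_def by blast
    have "map fst (map (\<lambda>p. (p, gen p)) M) = M" by (simp add: comp_def)
    with M show "\<exists>L. set L \<subseteq> set T \<and> spell L = u"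
      unfolding spell_def T by (intro exI[of _ "map (\<lambda>p. (p, gen p)) M"]) auto
  next
    assume "\<exists>L. set L \<subseteq> set T \<and> spell L = u"
    then obtain L where L: "set L \<subseteq> set T" "spell L = u" by blast
    with fst(1)[OF L(1)] show "u \<in> star short_pieces"
      unfolding star_def spell_def by blast
  qed
qed

text \<open>Lists over \<open>T\<close> have words over the group alphabet as second components, so
  \<open>D\<close> is consulted only where it is known to be right, and its answer translates to
  equality in the monoid.\<close>

lemma set_reducts_eq_red:
  assumes T: "set T = (\<lambda>p. (p, gen p)) ` short_pieces"
    and D: "\<And>U V. U \<in> words unit_group \<Longrightarrow> V \<in> words unit_group \<Longrightarrow> D U V \<longleftrightarrow> eq_in unit_group U V"
  shows "Y \<in> set (reducts T D B X) \<longleftrightarrow> red X Y"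
proof -
  note spell = star_short_pieces_spell[OF T]
  have D_iff: "D (map snd L) (map snd M) \<longleftrightarrow> spell L \<approx> spell M"
    if "set L \<subseteq> set T" "set M \<subseteq> set T" for L M
  proof -
    have "spell L \<in> star piecelike" "spell M \<in> star piecelike"
      using that spell(1) star_short_pieces_piecelike by blast+
    then show ?thesis
      using that D gen_word_words eqv_iff_gen_word_eq spell(2) by metis
  qed
  show ?thesis
  proof
    assume "Y \<in> set (reducts T D B X)"
    then obtain i L M where *: "i \<le> length X" "set L \<subseteq> set T" "set M \<subseteq> set T"
      "take (length (spell L)) (drop i X) = spell L" "rank B (spell M) < rank B (spell L)"
      "D (map snd L) (map snd M)" "Y = take i X @ spell M @ drop (i + length (spell L)) X"
      unfolding set_reducts set_lists_upto by blast
    have "X = take i X @ take (length (spell L)) (drop i X) @ drop (length (spell L)) (drop i X)"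
      by (simp only: append_take_drop_id)
    then have "X = take i X @ spell L @ drop (i + length (spell L)) X"
      using *(4) by (simp add: add.commute)
    moreover have "spell L \<approx> spell M" using D_iff * by blast
    moreover have "spell L \<in> star short_pieces" "spell M \<in> star short_pieces"
      using spell(1) * by blast+
    ultimately show "red X Y" unfolding red_def using *(5,7) by blast
  next
    assume "red X Y"
    then obtain a u u' b where *: "X = a @ u @ b" "Y = a @ u' @ b" "u \<in> star short_pieces"
      "u' \<in> star short_pieces"
      "u \<approx> u'" "rank B u' < rank B u"
      unfolding red_def by blast
    then obtain L M where L: "set L \<subseteq> set T" "spell L = u" and M: "set M \<subseteq> set T" "spell M = u'"
      using spell(1) by blast
    have "length u' \<le> length u"
      using rank_le_imp_length_le[OF B] * invertibles_letters star_short_pieces_invertibles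
      by (meson less_imp_le subsetD)
    then have "length L \<le> length X" "length M \<le> length X"
      using spell(3)[OF L(1)] spell(3)[OF M(1)] L(2) M(2) *(1) by auto
    moreover have "D (map snd L) (map snd M)" using D_iff L M * by blast
    moreover have "take (length u) (drop (length a) X) = u" "length a \<le> length X"
      "Y = take (length a) X @ u' @ drop (length a + length u) X"
      using *(1,2) by simp_all
    ultimately show "Y \<in> set (reducts T D B X)"
      unfolding set_reducts set_lists_upto using L M *(6) by blast
  qed
qed

lemma normal_form_correct:
  assumes reducts: "\<And>X Y. Y \<in> set (reducts T D B X) \<longleftrightarrow> red X Y"
  shows "red\<^sup>*\<^sup>* X (normal_form T D B X)" and "\<not> red (normal_form T D B X) Y"
proof -
  define it where "it = rec_nat X (\<lambda>_ Y. case reducts T D B Y of [] \<Rightarrow> Y | Z # _ \<Rightarrow> Z)"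
  have it: "it (Suc n) = it n \<and> (\<forall>Y. \<not> red (it n) Y) \<or> red (it n) (it (Suc n))" for n
  proof (cases "reducts T D B (it n)")
    case Nil
    then have "it (Suc n) = it n" unfolding it_def by simp
    moreover have "\<not> red (it n) Y" for Y using Nil reducts[of Y "it n"] by simp
    ultimately show ?thesis by blast
  next
    case (Cons Z Zs)
    then have "it (Suc n) = Z" unfolding it_def by simp
    moreover have "red (it n) Z" using Cons reducts[of Z "it n"] by simp
    ultimately show ?thesis by simp
  qed
  have reach: "red\<^sup>*\<^sup>* X (it n)" for n
  proof (induction n)
    case (Suc n)
    then show ?case using it[of n] by (metis rtranclp.rtrancl_into_rtrancl)
  qed (simp add: it_def)
  have "(\<forall>Y. \<not> red (it n) Y) \<or> rank B (it n) + n \<le> rank B X" for n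
  proof (induction n)
    case (Suc n)
    then show ?case
    proof (cases "\<forall>Y. \<not> red (it n) Y")
      case True
      then show ?thesis using it[of n] by auto
    next
      case False
      then have "red (it n) (it (Suc n))" using it[of n] by blast
      then have "rank B (it (Suc n)) < rank B (it n)" by (rule red_rank)
      moreover have "rank B (it n) + n \<le> rank B X" using Suc False by blast
      ultimately show ?thesis by simp
    qed
  qed (simp add: it_def)
  from this[of "rank B X"] have irred: "\<not> red (it (rank B X)) Y" for Y
    using rank_pos[of B "it (rank B X)"] B by auto
  have "normal_form T D B X = it (rank B X)"
    unfolding normal_form_def it_def by simp
  then show "red\<^sup>*\<^sup>* X (normal_form T D B X)" "\<not> red (normal_form T D B X) Y"
    using reach irred by simp_all
qed

text \<open>The table \<open>T\<close> exists because there are finitely many short pieces; it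
  enters the program as a constant.\<close>

lemma decidable_eqv:
  assumes D: "\<And>U V. U \<in> words unit_group \<Longrightarrow> V \<in> words unit_group \<Longrightarrow> D U V \<longleftrightarrow> eq_in unit_group U V"
    and dec: "decidable (\<lambda>p. D (fst p) (snd p))"
  shows "decidable (\<lambda>p. fst p \<approx> snd p)"
proof -
  obtain T where T: "set T = (\<lambda>p. (p, gen p)) ` short_pieces"
    using finite_list[OF finite_imageI[OF finite_short_pieces]] ..
  note nf = normal_form_correct[of T D, OF set_reducts_eq_red[OF T D]]
  have *: "X \<approx> Y \<longleftrightarrow> normal_form T D B X = normal_form T D B Y" for X Y
    by (rule eqv_iff_normal_forms_eq[of "normal_form T D B", OF nf])
  show ?thesis
    unfolding * by (intro computable_intros dec)
qed

end

section \<open>Renaming the letters\<close>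

text \<open>An absent element gets the length of the list.\<close>

definition position :: "'a \<Rightarrow> 'a list \<Rightarrow> nat" where
  "position x C = foldr (\<lambda>y n. if y = x then 0 else Suc n) C 0"

lemma computable_position [computable_intros]:
  assumes "computable x" "computable C"
  shows "computable (\<lambda>p. position (x p) (C p))"
  unfolding position_def foldr_conv_foldl by (intro computable_intros assms[THEN computable_comp])

lemma position_less: "x \<in> set xs \<Longrightarrow> position x (xs @ ys) < length xs"
  by (induction xs) (auto simp: position_def)

lemma nth_position: "x \<in> set xs \<Longrightarrow> xs ! position x xs = x"
  by (induction xs) (auto simp: position_def)

text \<open>A letter becomes the index of its first occurrence, so names may skip numbers. As the
  relators come first, the names of their letters stay below the total length of the relators,
  whatever the two words are.\<close>

definition normalize :: "word list \<times> word \<times> word \<Rightarrow> word list \<times> word \<times> word" where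
  "normalize p = (let \<rho> = (\<lambda>x. position x (concat (fst p) @ fst (snd p) @ snd (snd p)))
     in (map (map \<rho>) (fst p), map \<rho> (fst (snd p)), map \<rho> (snd (snd p))))"

lemma computable_normalize: "computable normalize"
  unfolding normalize_def[abs_def] Let_def by (intro computable_intros)

text \<open>Looking up indices in \<open>C\<close> undoes the renaming, so both directions are
  letter substitutions, which preserve equality.\<close>

lemma eq_in_normalize:
  assumes "normalize (As, X, Y) = (As', X', Y')"
  shows "eq_in (n, As) X Y \<longleftrightarrow> eq_in (m, As') X' Y'"
proof -
  define C where "C = concat As @ X @ Y"
  define \<rho> where "\<rho> x = position x C" for x
  have eqs: "As' = map (map \<rho>) As" "X' = map \<rho> X" "Y' = map \<rho> Y"
    using assms unfolding normalize_def \<rho>_def C_def by (simp_all add: Let_def)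
  have inv: "map ((!) C) (map \<rho> w) = w" if "set w \<subseteq> set C" for w
    using that by (induction w) (auto simp: \<rho>_def nth_position)
  have "map (map ((!) C)) (map (map \<rho>) As) = As"
    by (simp only: map_map comp_def, rule map_idI) (use inv in \<open>auto simp: C_def comp_def\<close>)
  moreover have "map ((!) C) (map \<rho> X) = X" "map ((!) C) (map \<rho> Y) = Y"
    using inv[of X] inv[of Y]
    by (simp_all only: C_def set_append Un_upper1 Un_upper2 le_supI1 le_supI2)
  ultimately show ?thesis
    unfolding eqs using eq_in_rename[of n As X Y m \<rho>]
      eq_in_rename[of m "map (map \<rho>) As" "map \<rho> X" "map \<rho> Y" n "(!) C"] by metis
qed

lemma normalize_relators:
  assumes "normalize (As, X, Y) = (As', X', Y')" "\<And>A. A \<in> set As \<Longrightarrow> length A \<le> l"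
  shows "length As' = length As" and "A \<in> set As' \<Longrightarrow> length A \<le> l"
    and "A \<in> set As' \<Longrightarrow> set A \<subseteq> {..<length As * l}"
proof -
  define \<rho> where "\<rho> x = position x (concat As @ X @ Y)" for x
  have As': "As' = map (map \<rho>) As"
    using assms(1) unfolding normalize_def \<rho>_def by (simp add: Let_def)
  have len: "length (concat As) \<le> length As * l"
    using assms(2)
  proof (induction As)
    case (Cons A As)
    then have "length (concat As) \<le> length As * l" "length A \<le> l" by auto
    then show ?case by simp
  qed simp
  show "length As' = length As" "A \<in> set As' \<Longrightarrow> length A \<le> l"
    using assms(2) by (auto simp: As')
  assume "A \<in> set As'"
  then obtain A0 where A0: "A0 \<in> set As" "A = map \<rho> A0" by (auto simp: As')
  have "\<rho> x < length As * l" if "x \<in> set A0" for x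
  proof -
    have "x \<in> set (concat As)" using that A0 by auto
    from position_less[OF this] len show ?thesis unfolding \<rho>_def by (rule less_le_trans)
  qed
  then show "set A \<subseteq> {..<length As * l}" by (auto simp: A0)
qed

section \<open>The reduction\<close>

lemma decidable_eq_in_of_group_solver:
  assumes f: "solves_identity_problem f (kl_group k l)"
    and group: "kl_group k l (n, Bs)"
  obtains D where "decidable (\<lambda>p. D (fst p) (snd p))"
    and "\<And>U V. U \<in> words (n, Bs) \<Longrightarrow> V \<in> words (n, Bs) \<Longrightarrow> D U V \<longleftrightarrow> eq_in (n, Bs) U V"
proof
  \<comment> \<open>The solver may diverge on words with letters outside the alphabet of the group.\<close>
  define restrict :: "word \<Rightarrow> word" where "restrict = filter (\<lambda>d. d < n)"
  define D where "D U V \<longleftrightarrow> eq_in (n, Bs) (restrict U) (restrict V)" for U V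
  have words: "restrict U \<in> words (n, Bs)" for U
    by (auto simp: restrict_def words_def)
  have "computable (\<lambda>p :: word \<times> word. restrict (fst p))"
    "computable (\<lambda>p :: word \<times> word. restrict (snd p))"
    "computable (\<lambda>p :: word \<times> word. n)" "computable (\<lambda>p :: word \<times> word. Bs)"
    unfolding restrict_def by (intro computable_intros)+
  then obtain r1 r2 r3 r4 where r: "computes r1 [enc p] (enc (restrict (fst p)))"
    "computes r2 [enc p] (enc (restrict (snd p)))" "computes r3 [enc p] (enc n)"
    "computes r4 [enc p] (enc Bs)" for p :: "word \<times> word"
    unfolding computable_def by blast
  have "computes f [enc n, enc Bs, enc (restrict U), enc (restrict V)] (if D U V then 1 else 0)" for U V
    using f group words
    unfolding solves_identity_problem_def D_def enc_nat enc_nat_list enc_nat_list_list by blast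
  from this[of "fst p" "snd p" for p]
  have "computes (Comp f [r3, r4, r1, r2]) [enc p] (enc (of_bool (D (fst p) (snd p)) :: nat))" for p
    by (intro computes.Comp[where ys = "[enc n, enc Bs, enc (restrict (fst p)), enc (restrict (snd p))]"])
      (use r in \<open>simp_all add: of_bool_def\<close>)
  then show "decidable (\<lambda>p. D (fst p) (snd p))"
    unfolding decidable_def computable_def by blast
  fix U V assume "U \<in> words (n, Bs)" "V \<in> words (n, Bs)"
  then have "restrict U = U" "restrict V = V"
    by (auto simp: restrict_def words_def filter_id_conv)
  then show "D U V \<longleftrightarrow> eq_in (n, Bs) U V"
    unfolding D_def by simp
qed

lemma decidable_eq_in:
  assumes f: "solves_identity_problem f (kl_group k l)"
    and R: "length R = k" "\<And>A. A \<in> set R \<Longrightarrow> length A \<le> l"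
  shows "decidable (\<lambda>p. eq_in (0, R) (fst p) (snd p))"
proof -
  \<comment> \<open>Two above the largest letter, to exceed all letters and to be at least 2 as a
    base; the added 0 covers the case without letters.\<close>
  define B where "B = Suc (Suc (Max (insert 0 (set (concat R)))))"
  interpret bounded_special_monoid R l B
  proof
    show "set A \<subseteq> {..<B}" if "A \<in> set R" for A
    proof
      fix x assume "x \<in> set A"
      then have "x \<le> Max (insert 0 (set (concat R)))" using that by (intro Max_ge) auto
      then show "x \<in> {..<B}" by (simp add: B_def)
    qed
  qed (use R in \<open>auto simp: B_def\<close>)
  obtain n Bs where unit_group: "unit_group = (n, Bs)" by (cases unit_group)
  have "kl_group k l (n, Bs)" using unit_group_group[OF R] unit_group by simp
  then obtain D where "decidable (\<lambda>p. D (fst p) (snd p))"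
    and "\<And>U V. U \<in> words unit_group \<Longrightarrow> V \<in> words unit_group \<Longrightarrow> D U V \<longleftrightarrow> eq_in unit_group U V"
    using decidable_eq_in_of_group_solver[OF f] unfolding unit_group by blast
  then show ?thesis by (intro decidable_eqv)
qed

theorem theorem4:
  fixes k l :: nat
  assumes "\<exists>f. solves_identity_problem f (kl_group k l)"
  shows "\<exists>f. solves_identity_problem f (kl_semigroup k l)"
proof -
  from assms obtain f where f: "solves_identity_problem f (kl_group k l)" ..
  \<comment> \<open>Every normalized list of relators lies here: \<open>k * l\<close> bounds the
    total length of the relators and hence the names of their letters.\<close>
  define S where "S = {As. set As \<subseteq> {A :: word. set A \<subseteq> {..<k * l} \<and> length A \<le> l} \<and> length As = k}"
  have "finite S"
    unfolding S_def by (intro finite_lists_length_eq finite_lists_length_le) simp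
  moreover have "computable (\<lambda>p. of_bool (eq_in (0, As) (fst p) (snd p)) :: nat)" if "As \<in> S" for As
    using decidable_eq_in[OF f, of As] that unfolding decidable_def S_def by auto
  ultimately obtain H where H: "computable H"
    and H_eq: "As \<in> S \<Longrightarrow> H (As, p) = (of_bool (eq_in (0, As) (fst p) (snd p)) :: nat)" for As p
    using computable_finite_cases[of S "\<lambda>As p. of_bool (eq_in (0, As) (fst p) (snd p)) :: nat"] by
      blast
  obtain r where r: "computes r [enc p] (H (normalize p))" for p
    using computable_comp[OF H computable_normalize] unfolding computable_def enc_nat by blast
  let ?f = "Comp r [Comp pair_rec [Proj 1, Comp pair_rec [Proj 2, Proj 3]]]"
  have "computes ?f [n, list_encode (map list_encode As), list_encode X, list_encode Y]
      (if eq_in (n, As) X Y then 1 else 0)" if "kl_semigroup k l (n, As)" for n As X Y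
  proof -
    obtain As' X' Y' where norm: "normalize (As, X, Y) = (As', X', Y')" by (metis prod_cases3)
    have len: "length As = k" "\<And>A. A \<in> set As \<Longrightarrow> length A \<le> l"
      using that unfolding kl_semigroup_def by auto
    have "As' \<in> S"
      using normalize_relators[OF norm len(2)] len(1) unfolding S_def by auto
    then have "H (normalize (As, X, Y)) = (if eq_in (n, As) X Y then 1 else 0)"
      using H_eq eq_in_normalize[OF norm, of n 0] norm by simp
    then have "computes r [enc (As, X, Y)] (if eq_in (n, As) X Y then 1 else 0)"
      using r[of "(As, X, Y)"] by simp
    then show ?thesis
      unfolding enc_Pair enc_nat_list enc_nat_list_list
      by (rule computes_Comp1[rotated])
        (intro computes_Comp2[OF _ _ computes_pair] computes_Proj; simp)
  qed
  then show ?thesis unfolding solves_identity_problem_def by blast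
qed

end
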